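(* Let $r>2$ and $d\ge 2$ be fixed integers and $s^*:=\binom{\lfloor d/2\rfloor+r-1}{r-1}$. Then the average-case complexity $E[X]$ of the SVS algorithm is bounded in the following way: $$E[X]\le \tau(d,r,q)\,\big(\mu_d^{-1}+d(1-d^{-1})^{s^*}\big)+\mathcal{O}(q^{-1/2}),$$ where $\tau(d,r,q)$ is the cost of the search in a vertical strip.
   Context: $\mathbb{F}_q$ is the finite field with $q$ elements, and $\mathcal{F}_{r,d}$ is the set of all polynomials $F\in\mathbb{F}_q[X_1,\dots,X_r]$ of total degree at most $d$. Put $\mu_d:=\sum_{j=1}^d\frac{(-1)^{j-1}}{j!}$. Let $\mathsf{F}$ be the set of all tuples $\underline{a}=(a_1,\dots,a_{q^{r-1}})$ of pairwise distinct elements of $\mathbb{F}_q^{r-1}$. The SVS ("Search on Vertical Strips") algorithm: on input $F\in\mathcal{F}_{r,d}$ and with random choice $\underline{a}\in\mathsf{F}$, it considers successively $i=1,2,\dots,q^{r-1}$; at step $i$ it searches the vertical strip $\{a_i\}\times\mathbb{F}_q$, that is, it computes $f:=\gcd(F(a_i,X_r),X_r^q-X_r)$ and, if $f\ne 1$, computes a root $x\in\mathbb{F}_q$ of $F(a_i,X_r)$ (a random element of $\mathbb{F}_q$ if $f=0$), outputs $(a_i,x)$ and stops; otherwise it passes to the next $i$. If all strips are exhausted it returns "failure". The univariate root-finding routine uses random choices of $r_d$ elements of $\mathbb{F}_q$, for a certain $r_d\in\mathbb{N}$; let $\Omega_d:=\mathbb{F}_q^{r_d}$. $X(\underline{a},F,\omega)$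 denotes the number of arithmetic operations in $\mathbb{F}_q$ performed by the algorithm (ignoring the cost of random generation) on input $F$ with choice of strips $\underline{a}\in\mathsf{F}$ and choice $\omega\in\Omega_d$, and $$E[X]:=\frac{1}{|\mathsf{F}|\,|\mathcal{F}_{r,d}|\,|\Omega_d|}\sum_{(\underline{a},F,\omega)\in\mathsf{F}\times\mathcal{F}_{r,d}\times\Omega_d}X(\underline{a},F,\omega).$$ $\tau(d,r,q)$ is the maximum number of arithmetic operations in $\mathbb{F}_q$ necessary to perform a search in one arbitrary vertical strip, which is $\mathcal{O}^{\sim}(D+d\log_2 q)$ with $D:=\binom{d+r}{r}$, where $\mathcal{O}^{\sim}$ ignores logarithmic factors. Thus $X(\underline{a},F,\omega)$ is at most $\tau(d,r,q)$ times the number of vertical strips searched, this number being the least $i$ such that $F(a_i,X_r)$ has a zero in $\mathbb{F}_q$, or $q^{r-1}$ if there is no such $i$. Asymptotic estimates are for fixed $d$ and $r$ and $q\to\infty$; implied constants may depend on $d$ and $r$ but not on $q$. *)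

theory Defs
  imports Complex_Main "HOL-Library.Landau_Symbols"
    "HOL-Algebra.UnivPoly" "HOL-Algebra.Indexed_Polynomials"
begin

text \<open>
  The field with q elements is a record \<open>K\<close> of HOL-Algebra rather than a type of class
  \<open>field\<close>, so that constants can be chosen uniformly in q inside one formula.
  Points of the affine n-space over \<open>K\<close> are lists of length n, and the variables
  \<open>X\<^sub>1, \<dots>, X\<^sub>r\<close> have the indices \<open>0, \<dots>, r - 1\<close>;
  the vertical direction is the last variable, with index \<open>r - 1\<close>.
\<close>

definition affine_space :: "('a, 'm) ring_scheme \<Rightarrow> nat \<Rightarrow> 'a list set" where
  "affine_space K n = {x. set x \<subseteq> carrier K \<and> length x = n}"

type_synonym 'a mpoly = "nat multiset \<Rightarrow> 'a"

definition mpolys :: "('a, 'm) ring_scheme \<Rightarrow> nat \<Rightarrow> nat \<Rightarrow> 'a mpoly set" where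
  "mpolys K r d =
     {F \<in> ring.indexed_pset K {..<r} (carrier K). \<forall>m. F m \<noteq> \<zero>\<^bsub>K\<^esub> \<longrightarrow> size m \<le> d}"

text \<open>
  The univariate polynomial \<open>F(a, X\<^sub>r)\<close>, as a coefficient sequence in the sense
  of \<open>UP K\<close>.
\<close>

definition strip_poly :: "('a, 'm) ring_scheme \<Rightarrow> nat \<Rightarrow> 'a mpoly \<Rightarrow> 'a list \<Rightarrow> (nat \<Rightarrow> 'a)" where
  "strip_poly K r F a = (\<lambda>j.
     \<Oplus>\<^bsub>K\<^esub>m \<in> {m. F m \<noteq> \<zero>\<^bsub>K\<^esub> \<and> count m (r - 1) = j}.
       F m \<otimes>\<^bsub>K\<^esub> (\<Otimes>\<^bsub>K\<^esub>i \<in> {..<r - 1}. (a ! i) [^]\<^bsub>K\<^esub> count m i))"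

text \<open>The polynomial \<open>X\<^sup>q - X\<close>, where q is the number of elements of \<open>K\<close>.\<close>

definition frobenius_poly :: "('a, 'm) ring_scheme \<Rightarrow> (nat \<Rightarrow> 'a)" where
  "frobenius_poly K =
     up_ring.monom (UP K) \<one>\<^bsub>K\<^esub> (order K) \<ominus>\<^bsub>UP K\<^esub> up_ring.monom (UP K) \<one>\<^bsub>K\<^esub> 1"

text \<open>
  A gcd is determined up to units only; it equals 1 after normalization iff 1 is a gcd.
\<close>

definition gcd_is_one :: "('a, 'm) ring_scheme \<Rightarrow> nat \<Rightarrow> 'a mpoly \<Rightarrow> 'a list \<Rightarrow> bool" where
  "gcd_is_one K r F a \<longleftrightarrow>
     \<one>\<^bsub>UP K\<^esub> gcdof\<^bsub>UP K\<^esub> (strip_poly K r F a) (frobenius_poly K)"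

text \<open>
  The univariate subroutines of the search in the strip over \<open>a\<close>, on input \<open>F\<close> and with
  random choice \<open>\<omega>\<close>: the number of arithmetic operations spent on the gcd, the number
  spent on computing a root, and the root itself. The routines are parameters: nothing is
  assumed about them, so that root finders which fail for some \<open>\<omega>\<close> are included as well.
\<close>

record 'a search_routine =
  gcd_ops :: "'a mpoly \<Rightarrow> 'a list \<Rightarrow> nat"
  root_ops :: "'a mpoly \<Rightarrow> 'a list \<Rightarrow> 'a list \<Rightarrow> nat"
  root_of :: "'a mpoly \<Rightarrow> 'a list \<Rightarrow> 'a list \<Rightarrow> 'a"

definition strip_ops ::
  "('a, 'm) ring_scheme \<Rightarrow> nat \<Rightarrow> 'a search_routine \<Rightarrow> 'a mpoly \<Rightarrow> 'a list \<Rightarrow> 'a list \<Rightarrow> nat" where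
  "strip_ops K r S F \<omega> a =
     (if gcd_is_one K r F a then gcd_ops S F a else gcd_ops S F a + root_ops S F a \<omega>)"

text \<open>
  SVS on a list of strips. The first component of the result is the output, where \<open>None\<close>
  stands for failure; the second one is the number of arithmetic operations performed.
\<close>

fun svs ::
  "('a, 'm) ring_scheme \<Rightarrow> nat \<Rightarrow> 'a search_routine \<Rightarrow> 'a mpoly \<Rightarrow> 'a list \<Rightarrow> 'a list list
     \<Rightarrow> ('a list \<times> 'a) option \<times> nat" where
  "svs K r S F \<omega> [] = (None, 0)"
| "svs K r S F \<omega> (a # as) =
     (if gcd_is_one K r F a
      then (let (out, n) = svs K r S F \<omega> as in (out, strip_ops K r S F \<omega> a + n))
      else (Some (a, root_of S F a \<omega>), strip_ops K r S F \<omega> a))"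

definition svs_ops ::
  "('a, 'm) ring_scheme \<Rightarrow> nat \<Rightarrow> 'a search_routine \<Rightarrow> 'a list list \<Rightarrow> 'a mpoly \<Rightarrow> 'a list \<Rightarrow> nat" where
  "svs_ops K r S as F \<omega> = snd (svs K r S F \<omega> as)"

definition strip_choices :: "('a, 'm) ring_scheme \<Rightarrow> nat \<Rightarrow> 'a list list set" where
  "strip_choices K r =
     {as. set as \<subseteq> affine_space K (r - 1) \<and> distinct as \<and> length as = order K ^ (r - 1)}"

text \<open>
  In the next two definitions \<open>n\<close> is the number of field elements drawn by the root
  finder, so that \<open>affine_space K n\<close> is the sample space of its random choices.
\<close>

definition average_ops ::
  "('a, 'm) ring_scheme \<Rightarrow> nat \<Rightarrow> nat \<Rightarrow> nat \<Rightarrow> 'a search_routine \<Rightarrow> real" where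
  "average_ops K r d n S =
     1 / (real (card (strip_choices K r)) * real (card (mpolys K r d))
          * real (card (affine_space K n)))
     * (\<Sum>(as, F, \<omega>) \<in> strip_choices K r \<times> mpolys K r d \<times> affine_space K n.
          real (svs_ops K r S as F \<omega>))"

definition tau ::
  "('a, 'm) ring_scheme \<Rightarrow> nat \<Rightarrow> nat \<Rightarrow> nat \<Rightarrow> 'a search_routine \<Rightarrow> nat" where
  "tau K r d n S =
     Max {strip_ops K r S F \<omega> a | F \<omega> a.
            F \<in> mpolys K r d \<and> \<omega> \<in> affine_space K n \<and> a \<in> affine_space K (r - 1)}"

definition mu :: "nat \<Rightarrow> real" where
  "mu d = (\<Sum>j = 1..d. (- 1) ^ (j - 1) / fact j)"

definition s_star :: "nat \<Rightarrow> nat \<Rightarrow> nat" where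
  "s_star d r = (d div 2 + r - 1) choose (r - 1)"

end

theory Submission
  imports Defs "HOL-Combinatorics.Multiset_Permutations" "HOL-Algebra.Multiplicative_Group"
    "HOL-Real_Asymp.Real_Asymp"
begin

text \<open>
  Let \<open>M = q\<^sup>r\<^sup>-\<^sup>1\<close> and let \<open>N(F)\<close> be the number of vertical strips in which \<open>F\<close> has a zero. For a uniformly
  random order of the strips the expected number of strips searched is at most
  \<open>(M + 1) / (N(F) + 1)\<close>, so it suffices to bound the mean of this quantity over \<open>F\<close>. Fix the
  coefficient \<open>c\<close> of the d-th power of the last variable.

  The events ``the strip over \<open>a\<close> contains a zero'' are pairwise independent, since
  \<open>F(a, X\<^sub>r)\<close> can be translated by any polynomial of degree less than \<open>d\<close> without changing
  \<open>F(b, X\<^sub>r)\<close>. For \<open>c \<noteq> 0\<close> their probability tends to \<open>\<mu>\<^sub>d\<close> by inclusion-exclusion. Hence \<open>N(F)\<close> is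
  concentrated around \<open>\<mu>\<^sub>d M\<close>. The class \<open>c = 0\<close> has probability \<open>1/q\<close> and contributes
  \<open>O(1/q)\<close>.

  Chebyshev's inequality gives only \<open>O(1/M)\<close> for the probability that \<open>N(F)\<close> is very small, and
  there \<open>(M + 1) / (N(F) + 1)\<close> can be as large as \<open>M + 1\<close>. For \<open>N(F) \<le> M/(2d)\<close> a fourth moment is used instead:
  centered at their probability over the constant term, the events are 4-wise uncorrelated
  under translation by quadratic polynomials in \<open>X\<^sub>1, \<dots>, X\<^sub>r\<^sub>-\<^sub>1\<close>, except along lines, and
  this makes the probability \<open>O(q/M\<^sup>2)\<close>.

  So the mean number of strips tends to \<open>1/\<mu>\<^sub>d\<close>, and the positive constant
  \<open>d(1 - 1/d)\<^sup>s\<close> with \<open>s = s\<^sup>*\<close> absorbs all error terms: \<open>err = 0\<close> works.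
\<close>

subsection \<open>Averages, moments and random orders\<close>

text \<open>An injective self-map of a finite set permutes it, so averaging over all
  \<open>T h\<close> leaves the sum unchanged. The invariant factor \<open>\<psi>\<close> comes out
  of the average and \<open>\<phi>\<close> is replaced by its orbit mean \<open>\<kappa>\<close>.
  With \<open>\<kappa> = 0\<close> this yields the orthogonality behind all moment bounds
  below.\<close>

lemma sum_translation_average:
  fixes \<phi> \<psi> :: "'f \<Rightarrow> real"
  assumes A: "finite A" and H: "finite H" "H \<noteq> {}"
    and T: "\<And>h. h \<in> H \<Longrightarrow> T h ` A \<subseteq> A" "\<And>h. h \<in> H \<Longrightarrow> inj_on (T h) A"
    and \<psi>: "\<And>h F. h \<in> H \<Longrightarrow> F \<in> A \<Longrightarrow> \<psi> (T h F) = \<psi> F"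
    and \<phi>: "\<And>F. F \<in> A \<Longrightarrow> (\<Sum>h\<in>H. \<phi> (T h F)) = real (card H) * \<kappa>"
  shows "(\<Sum>F\<in>A. \<phi> F * \<psi> F) = \<kappa> * (\<Sum>F\<in>A. \<psi> F)"
proof -
  have "real (card H) * (\<Sum>F\<in>A. \<phi> F * \<psi> F) = (\<Sum>h\<in>H. \<Sum>F\<in>A. \<phi> F * \<psi> F)"
    by simp
  also have "\<dots> = (\<Sum>h\<in>H. \<Sum>F\<in>A. \<phi> (T h F) * \<psi> F)"
  proof (rule sum.cong[OF refl])
    fix h assume h: "h \<in> H"
    have "bij_betw (T h) A A"
      using endo_inj_surj[OF A T(1)[OF h] T(2)[OF h]] T(2)[OF h] by (simp add: bij_betw_def)
    then have "(\<Sum>F\<in>A. \<phi> F * \<psi> F) = (\<Sum>F\<in>A. \<phi> (T h F) * \<psi> (T h F))"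
      by (rule sum.reindex_bij_betw[symmetric])
    then show "(\<Sum>F\<in>A. \<phi> F * \<psi> F) = (\<Sum>F\<in>A. \<phi> (T h F) * \<psi> F)"
      using \<psi>[OF h] by simp
  qed
  also have "\<dots> = (\<Sum>F\<in>A. (\<Sum>h\<in>H. \<phi> (T h F)) * \<psi> F)"
    by (subst sum.swap) (simp add: sum_distrib_right)
  also have "\<dots> = (\<Sum>F\<in>A. real (card H) * \<kappa> * \<psi> F)"
    using \<phi> by simp
  also have "\<dots> = real (card H) * (\<kappa> * (\<Sum>F\<in>A. \<psi> F))"
    by (simp add: sum_distrib_left mult.assoc)
  finally show ?thesis using H by simp
qed

lemma square_sum_eq:
  fixes f :: "'x \<Rightarrow> real"
  shows "(\<Sum>x\<in>P. f x)\<^sup>2 = (\<Sum>x\<in>P. \<Sum>y\<in>P. f x * f y)"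
  by (simp add: power2_eq_square sum_product)

text \<open>After expanding the square and summing over \<open>F\<close>, the off-diagonal products
  vanish and each diagonal square is at most 1.\<close>

lemma second_moment_le:
  fixes Z :: "'x \<Rightarrow> 'f \<Rightarrow> real"
  assumes P: "finite P"
    and bound: "\<And>x F. x \<in> P \<Longrightarrow> F \<in> A \<Longrightarrow> \<bar>Z x F\<bar> \<le> 1"
    and orth: "\<And>x y. x \<in> P \<Longrightarrow> y \<in> P \<Longrightarrow> x \<noteq> y \<Longrightarrow> (\<Sum>F\<in>A. Z x F * Z y F) = 0"
  shows "(\<Sum>F\<in>A. (\<Sum>x\<in>P. Z x F)\<^sup>2) \<le> real (card A) * real (card P)"
proof -
  have "(\<Sum>F\<in>A. (\<Sum>x\<in>P. Z x F)\<^sup>2) = (\<Sum>F\<in>A. \<Sum>x\<in>P. \<Sum>y\<in>P. Z x F * Z y F)"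
    by (simp add: square_sum_eq)
  also have "\<dots> = (\<Sum>x\<in>P. \<Sum>F\<in>A. \<Sum>y\<in>P. Z x F * Z y F)"
    by (rule sum.swap)
  also have "\<dots> = (\<Sum>x\<in>P. \<Sum>y\<in>P. \<Sum>F\<in>A. Z x F * Z y F)"
    by (intro sum.cong refl sum.swap)
  also have "\<dots> = (\<Sum>x\<in>P. \<Sum>y\<in>P. if y = x then \<Sum>F\<in>A. (Z x F)\<^sup>2 else 0)"
    using orth by (intro sum.cong refl) (auto simp: power2_eq_square)
  also have "\<dots> = (\<Sum>x\<in>P. \<Sum>F\<in>A. (Z x F)\<^sup>2)"
    using P by simp
  also have "\<dots> \<le> (\<Sum>x\<in>P. \<Sum>F\<in>A. 1)"
    using bound by (intro sum_mono) (simp add: abs_square_le_1)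
  finally show ?thesis by (simp add: mult.commute)
qed

text \<open>
  In the application the \<open>Z x\<close> are centered and 4-wise independent except for collinear
  points, and \<open>L x y\<close> is the line through \<open>x\<close> and \<open>y\<close>. Expanding only one of the two factors
  \<open>(\<Sum>x. Z x)\<^sup>2\<close> leaves for every pair \<open>x \<noteq> y\<close> a second moment along \<open>L x y\<close>.
\<close>

lemma fourth_moment_le:
  fixes Z :: "'x \<Rightarrow> 'f \<Rightarrow> real" and L :: "'x \<Rightarrow> 'x \<Rightarrow> 'x set"
  assumes P: "finite P"
    and bound: "\<And>x F. x \<in> P \<Longrightarrow> F \<in> A \<Longrightarrow> \<bar>Z x F\<bar> \<le> 1"
    and L: "\<And>x y. x \<in> P \<Longrightarrow> y \<in> P \<Longrightarrow> x \<noteq> y \<Longrightarrow>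
              L x y \<subseteq> P \<and> x \<in> L x y \<and> y \<in> L x y \<and> card (L x y) \<le> q"
    and orth2: "\<And>x y. x \<in> P \<Longrightarrow> y \<in> P \<Longrightarrow> x \<noteq> y \<Longrightarrow> (\<Sum>F\<in>A. Z x F * Z y F) = 0"
    and orth3: "\<And>x y z. x \<in> P \<Longrightarrow> y \<in> P \<Longrightarrow> z \<in> P \<Longrightarrow> x \<noteq> y \<Longrightarrow> x \<noteq> z \<Longrightarrow> y \<noteq> z \<Longrightarrow>
              (\<Sum>F\<in>A. Z x F * (Z y F * (Z z F * Z z F))) = 0"
    and orth4: "\<And>x y z w. x \<in> P \<Longrightarrow> y \<in> P \<Longrightarrow> z \<in> P \<Longrightarrow> w \<in> P \<Longrightarrow> x \<noteq> y \<Longrightarrow> w \<notin> L x y \<Longrightarrow>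
              z \<noteq> w \<Longrightarrow> (\<Sum>F\<in>A. Z w F * (Z x F * (Z y F * Z z F))) = 0"
  shows "(\<Sum>F\<in>A. (\<Sum>x\<in>P. Z x F) ^ 4) \<le> real (card A) * real (card P) ^ 2 * (real q + 1)"
proof -
  define S where "S = (\<lambda>F. \<Sum>x\<in>P. Z x F)"
  have pair: "(\<Sum>F\<in>A. Z x F * Z y F * (S F)\<^sup>2) \<le>
      (if x = y then real (card A) * real (card P) else real (card A) * real q)"
    if x: "x \<in> P" and y: "y \<in> P" for x y
  proof (cases "x = y")
    case True
    have "(\<Sum>F\<in>A. Z x F * Z y F * (S F)\<^sup>2) \<le> (\<Sum>F\<in>A. 1 * (S F)\<^sup>2)"
      using bound[OF x] True
      by (intro sum_mono mult_right_mono) (auto simp: abs_square_le_1 simp flip: power2_eq_square)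
    also have "\<dots> \<le> real (card A) * real (card P)"
      using second_moment_le[OF P bound orth2] by (simp add: S_def)
    finally show ?thesis using True by simp
  next
    case False
    note L' = L[OF x y False]
    let ?L = "L x y"
    have finL: "finite ?L" using L' P finite_subset by blast
    \<comment> \<open>A product survives only if both \<open>z\<close> and \<open>w\<close> lie on
      the line. If \<open>z = w\<close> is off the line, it differs from \<open>x\<close> and
      \<open>y\<close>, and \<open>orth3\<close> applies; if \<open>z \<noteq> w\<close>, then
      \<open>orth4\<close> applies to one of the two that is off the line.\<close>
    have vanish: "(\<Sum>F\<in>A. Z x F * Z y F * (Z z F * Z w F)) = 0"
      if z: "z \<in> P" and w: "w \<in> P" and nL: "\<not> (z \<in> ?L \<and> w \<in> ?L)" for z w
    proof (cases "z = w")
      case True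
      then have "z \<noteq> x" "z \<noteq> y" using nL L' by auto
      with orth3[OF x y z] False True show ?thesis by (simp add: mult.assoc)
    next
      case zw: False
      show ?thesis
      proof (cases "w \<in> ?L")
        case False
        from orth4[OF x y z w \<open>x \<noteq> y\<close> this zw] show ?thesis
          by (simp add: mult_ac)
      next
        case True
        then have "z \<notin> ?L" using nL by simp
        from orth4[OF x y w z \<open>x \<noteq> y\<close> this zw[symmetric]] show ?thesis
          by (simp add: mult_ac)
      qed
    qed
    have "(\<Sum>F\<in>A. Z x F * Z y F * (S F)\<^sup>2) =
        (\<Sum>F\<in>A. \<Sum>z\<in>P. \<Sum>w\<in>P. Z x F * Z y F * (Z z F * Z w F))"
      by (simp add: S_def square_sum_eq sum_distrib_left)
    also have "\<dots> = (\<Sum>z\<in>P. \<Sum>F\<in>A. \<Sum>w\<in>P. Z x F * Z y F * (Z z F * Z w F))"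
      by (rule sum.swap)
    also have "\<dots> = (\<Sum>z\<in>P. \<Sum>w\<in>P. \<Sum>F\<in>A. Z x F * Z y F * (Z z F * Z w F))"
      by (intro sum.cong refl sum.swap)
    also have "\<dots> = (\<Sum>z\<in>?L. \<Sum>w\<in>P. \<Sum>F\<in>A. Z x F * Z y F * (Z z F * Z w F))"
      using P L' vanish by (intro sum.mono_neutral_right) (auto intro!: sum.neutral)
    also have "\<dots> = (\<Sum>z\<in>?L. \<Sum>w\<in>?L. \<Sum>F\<in>A. Z x F * Z y F * (Z z F * Z w F))"
      using P L' vanish by (intro sum.cong refl sum.mono_neutral_right) auto
    also have "\<dots> = (\<Sum>z\<in>?L. \<Sum>F\<in>A. \<Sum>w\<in>?L. Z x F * Z y F * (Z z F * Z w F))"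
      by (intro sum.cong refl sum.swap)
    also have "\<dots> = (\<Sum>F\<in>A. \<Sum>z\<in>?L. \<Sum>w\<in>?L. Z x F * Z y F * (Z z F * Z w F))"
      by (rule sum.swap)
    \<comment> \<open>Folding the double sum over the line back into a square makes it nonnegative,
      so that the factor \<open>Z x F * Z y F\<close> can be bounded by 1 before the second moment
      along the line is used.\<close>
    also have "\<dots> = (\<Sum>F\<in>A. Z x F * Z y F * (\<Sum>z\<in>?L. Z z F)\<^sup>2)"
      by (simp add: square_sum_eq sum_distrib_left)
    also have "\<dots> \<le> (\<Sum>F\<in>A. 1 * (\<Sum>z\<in>?L. Z z F)\<^sup>2)"
    proof (intro sum_mono mult_right_mono)
      fix F assume "F \<in> A"
      then have "\<bar>Z x F\<bar> * \<bar>Z y F\<bar> \<le> 1 * 1"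
        using bound x y by (intro mult_mono) auto
      then show "Z x F * Z y F \<le> 1" by (simp flip: abs_mult)
    qed simp
    also have "\<dots> \<le> real (card A) * real (card ?L)"
      using bound orth2 L' by (simp, intro second_moment_le finL) blast+
    also have "\<dots> \<le> real (card A) * real q"
      using L' by (intro mult_left_mono) auto
    finally show ?thesis using False by simp
  qed
  have "(\<Sum>F\<in>A. (S F) ^ 4) = (\<Sum>F\<in>A. \<Sum>x\<in>P. \<Sum>y\<in>P. Z x F * Z y F * (S F)\<^sup>2)"
  proof (intro sum.cong refl)
    fix F
    have "S F ^ 4 = (S F)\<^sup>2 * (S F)\<^sup>2" by (simp add: power2_eq_square power4_eq_xxxx)
    also have "\<dots> = (\<Sum>x\<in>P. \<Sum>y\<in>P. Z x F * Z y F) * (S F)\<^sup>2"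
      by (simp add: square_sum_eq S_def)
    finally show "S F ^ 4 = (\<Sum>x\<in>P. \<Sum>y\<in>P. Z x F * Z y F * (S F)\<^sup>2)"
      by (simp add: sum_distrib_right)
  qed
  also have "\<dots> = (\<Sum>x\<in>P. \<Sum>F\<in>A. \<Sum>y\<in>P. Z x F * Z y F * (S F)\<^sup>2)"
    by (rule sum.swap)
  also have "\<dots> = (\<Sum>x\<in>P. \<Sum>y\<in>P. \<Sum>F\<in>A. Z x F * Z y F * (S F)\<^sup>2)"
    by (intro sum.cong refl sum.swap)
  also have "\<dots> \<le> (\<Sum>x\<in>P. \<Sum>y\<in>P. if x = y then real (card A) * real (card P) else real (card A) * real q)"
    by (intro sum_mono pair)
  also have "\<dots> \<le> (\<Sum>x\<in>P. \<Sum>y\<in>P. (if x = y then real (card A) * real (card P) else 0) + real (card A) * real q)"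
    by (intro sum_mono) auto
  also have "\<dots> = real (card A) * real (card P) ^ 2 * (real q + 1)"
    using P by (simp add: sum.distrib algebra_simps power2_eq_square)
  finally show ?thesis by (simp add: S_def)
qed

section \<open>Position of the first success in a random order\<close>

fun searched :: "('b \<Rightarrow> bool) \<Rightarrow> 'b list \<Rightarrow> nat" where
  "searched g [] = 0"
| "searched g (x # xs) = (if g x then 1 else Suc (searched g xs))"

text \<open>Induction by the first element: a good one costs 1, a bad one costs 1 plus the mean for
  the other \<open>n\<close> elements, which contain the same number \<open>N\<close> of good ones.
  The recursion closes because \<open>1 + (n + 1 - N) / (N + 1) = (n + 2) / (N + 1)\<close>. For
  \<open>N > 0\<close> the bound is the exact mean; for \<open>N = 0\<close> it exceeds the true
  value \<open>card A\<close> by 1.\<close>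

lemma sum_searched_permutations_le:
  assumes "finite A"
  shows "(\<Sum>xs\<in>permutations_of_set A. real (searched g xs)) \<le>
    fact (card A) * ((real (card A) + 1) / (real (card {x \<in> A. g x}) + 1))"
  using assms
proof (induction "card A" arbitrary: A)
  case 0
  then show ?case by simp
next
  case (Suc n)
  let ?N = "\<lambda>A. real (card {x \<in> A. g x})"
  have fin: "finite A" and ne: "A \<noteq> {}" using Suc by auto
  have "(\<Sum>xs\<in>permutations_of_set A. real (searched g xs)) =
      (\<Sum>x\<in>A. \<Sum>xs\<in>(\<lambda>xs. x # xs) ` permutations_of_set (A - {x}). real (searched g xs))"
    using fin by (subst permutations_of_set_nonempty[OF ne], subst sum.UNION_disjoint) auto
  also have "\<dots> = (\<Sum>x\<in>A. \<Sum>xs\<in>permutations_of_set (A - {x}). real (searched g (x # xs)))"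
    by (rule sum.cong[OF refl], subst sum.reindex) auto
  also have "\<dots> \<le> (\<Sum>x\<in>A. fact n + (if g x then 0 else fact n * ((real n + 1) / (?N A + 1))))"
  proof (rule sum_mono)
    fix x assume x: "x \<in> A"
    have n: "n = card (A - {x})" using Suc.hyps(2) x fin by simp
    show "(\<Sum>xs\<in>permutations_of_set (A - {x}). real (searched g (x # xs)))
        \<le> fact n + (if g x then 0 else fact n * ((real n + 1) / (?N A + 1)))"
    proof (cases "g x")
      case True
      then show ?thesis using fin n by simp
    next
      case False
      then have eq: "{y \<in> A - {x}. g y} = {y \<in> A. g y}" by auto
      have "(\<Sum>xs\<in>permutations_of_set (A - {x}). real (searched g xs)) \<le>
          fact n * ((real n + 1) / (?N A + 1))"
        using Suc.hyps(1)[OF n] fin n eq by simp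
      with False fin n show ?thesis by (simp add: sum.distrib)
    qed
  qed
  also have "\<dots> = fact n * (real (Suc n) + (real (Suc n) - ?N A) * ((real n + 1) / (?N A + 1)))"
  proof -
    have "(\<Sum>x\<in>A. if g x then 0 else fact n * ((real n + 1) / (?N A + 1))) =
        real (card (A - {x \<in> A. g x})) * (fact n * ((real n + 1) / (?N A + 1)))"
      using fin by (subst sum.If_cases) (auto intro!: arg_cong[where f = card])
    also have "real (card (A - {x \<in> A. g x})) = real (Suc n) - ?N A"
      using fin Suc.hyps(2) by (subst card_Diff_subset) (auto simp: of_nat_diff card_mono)
    finally show ?thesis
      using Suc.hyps(2) by (simp add: sum.distrib algebra_simps)
  qed
  also have "\<dots> = fact (card A) * ((real (card A) + 1) / (?N A + 1))"
  proof -
    have "?N A + 1 \<noteq> 0" by (metis add.commute of_nat_Suc of_nat_neq_0)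
    then show ?thesis unfolding Suc.hyps(2)[symmetric] fact_Suc of_nat_mult
      by (simp add: field_simps)
  qed
  finally show ?case .
qed

section \<open>Inclusion-exclusion and the limit constant \<open>mu d\<close>\<close>

lemma alternating_choose_sum:
  assumes "k \<le> d"
  shows "(\<Sum>j=1..d. (- 1) ^ (j - 1) * real (k choose j)) = of_bool (k > 0)"
proof (cases "k = 0")
  case False
  \<comment> \<open>The full alternating sum over a row of binomial coefficients vanishes for
    \<open>k > 0\<close>. Its term at \<open>j = 0\<close> is 1, and extending it from
    \<open>k\<close> to \<open>d\<close> adds only zeros.\<close>
  have "0 = (\<Sum>j\<le>k. (- 1) ^ j * real (k choose j))"
    using choose_alternating_sum[of k, where 'a = real] False by simp
  also have "\<dots> = (\<Sum>j\<le>d. (- 1) ^ j * real (k choose j))"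
    using assms by (intro sum.mono_neutral_left) auto
  also have "\<dots> = (\<Sum>j\<in>insert 0 {1..d}. (- 1) ^ j * real (k choose j))"
    by (intro sum.cong) auto
  also have "\<dots> = 1 + (\<Sum>j=1..d. (- 1) ^ j * real (k choose j))"
    by (subst sum.insert) auto
  also have "(\<Sum>j=1..d. (- 1) ^ j * real (k choose j)) =
      (\<Sum>j=1..d. - ((- 1) ^ (j - 1) * real (k choose j)))"
  proof (intro sum.cong refl)
    fix j assume "j \<in> {1..d}"
    then obtain i where "j = Suc i" by (cases j) auto
    then show "(- 1) ^ j * real (k choose j) = - ((- 1) ^ (j - 1) * real (k choose j))" by simp
  qed
  finally show ?thesis using False by (simp add: sum_negf)
qed (auto intro!: sum.neutral)

lemma card_filter_eq_sum:
  "finite A \<Longrightarrow> of_nat (card {x \<in> A. P x}) = (\<Sum>x\<in>A. of_bool (P x) :: 'c :: semiring_1)"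
  by (simp add: Int_def)

text \<open>Multisets encode exponent vectors: the multiplicity of \<open>i\<close> is the exponent
  of the variable with index \<open>i\<close>.\<close>

definition monomials :: "nat \<Rightarrow> nat \<Rightarrow> nat multiset set" where
  "monomials r e = {m. set_mset m \<subseteq> {..<r} \<and> size m \<le> e}"

lemma finite_monomials [simp]: "finite (monomials r e)"
proof -
  have "monomials r e \<subseteq> mset ` {xs. set xs \<subseteq> {..<r} \<and> length xs \<le> e}"
  proof
    fix m assume m: "m \<in> monomials r e"
    obtain xs where "mset xs = m" using ex_mset by blast
    then show "m \<in> mset ` {xs. set xs \<subseteq> {..<r} \<and> length xs \<le> e}"
      using m by (intro image_eqI[of _ _ xs]) (auto simp: monomials_def)
  qed
  then show ?thesis by (rule finite_subset) (simp add: finite_lists_length_le)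
qed

text \<open>Serves to isolate the top coefficient of a strip polynomial, which comes from a single
  monomial.\<close>

lemma count_eq_size_imp_replicate:
  assumes "size m \<le> n" "count m x = n"
  shows "m = replicate_mset n x"
proof -
  have "replicate_mset n x \<subseteq># m" using assms by (simp flip: count_le_replicate_mset_subset_eq)
  then obtain m' where m': "m = replicate_mset n x + m'" by (auto simp: mset_subset_eq_exists_conv)
  then have "size m' = 0" using assms by simp
  then show ?thesis using m' by simp
qed

text \<open>The series alternates with decreasing terms: the partial sums of even index increase
  from \<open>mu 2 = 1 / 2\<close>, and one of odd index exceeds its even predecessor. Later this
  supplies the positivity of \<open>mu d\<close>.\<close>

lemma mu_ge_half: "d \<ge> 2 \<Longrightarrow> mu d \<ge> 1 / 2"
proof -
  have Suc: "mu (Suc d) = mu d + (- 1) ^ d / fact (Suc d)" for d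
    by (simp add: mu_def)
  have ev: "mu (2 * k) \<ge> 1 / 2" if "k \<ge> 1" for k
    using that
  proof (induction k rule: dec_induct)
    case base
    show ?case using Suc[of 1] by (simp add: mu_def numeral_2_eq_2)
  next
    case (step k)
    have "(fact (Suc (2 * k)) :: real) \<le> fact (Suc (Suc (2 * k)))" by (rule fact_mono) simp
    then have "(1 :: real) / fact (Suc (Suc (2 * k))) \<le> 1 / fact (Suc (2 * k))"
      by (intro divide_left_mono) auto
    then have "mu (2 * k) \<le> mu (Suc (Suc (2 * k)))"
      using Suc[of "Suc (2 * k)"] Suc[of "2 * k"] by (simp del: fact_Suc)
    then show ?case using step.IH by simp
  qed
  assume d: "d \<ge> 2"
  show ?thesis
  proof (cases "even d")
    case True
    then obtain k where "d = 2 * k" by blast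
    with ev[of k] d show ?thesis by simp
  next
    case False
    then obtain k where k: "d = Suc (2 * k)" using oddE by fastforce
    then have "mu (2 * k) \<le> mu d" using Suc[of "2 * k"] by simp
    with ev[of k] k d show ?thesis by simp
  qed
qed

text \<open>For \<open>q \<ge> d > 0\<close>, this is the exact probability that a univariate
  polynomial of degree \<open>d\<close> with a fixed nonzero leading coefficient has a zero in a
  field with \<open>q\<close> elements: inclusion-exclusion over the \<open>j\<close>-subsets of the
  field, each of which consists of zeros with probability \<open>1 / q ^ j\<close>.\<close>

definition root_prob :: "nat \<Rightarrow> nat \<Rightarrow> real" where
  "root_prob d q = (\<Sum>j=1..d. (- 1) ^ (j - 1) * (real (q choose j) / real q ^ j))"

text \<open>The binomial coefficient is a falling factorial over \<open>fact j\<close>; after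
  division by \<open>q ^ j\<close>, each of its \<open>j\<close> factors \<open>(q - i) / q\<close>
  tends to 1.\<close>

lemma choose_div_power_tendsto: "(\<lambda>q. real (q choose j) / real q ^ j) \<longlonglongrightarrow> 1 / fact j"
proof -
  have eq: "real (q choose j) / real q ^ j = (\<Prod>i=0..<j. (real q - real i) / real q) / fact j" for q
    unfolding binomial_gbinomial gbinomial_prod_rev by (simp add: prod_dividef)
  have "(\<lambda>q. (real q - real i) / real q) \<longlonglongrightarrow> 1" for i :: nat
    by real_asymp
  then have "(\<lambda>q. (\<Prod>i=0..<j. (real q - real i) / real q) / fact j) \<longlonglongrightarrow> (\<Prod>i=0..<j. 1) / fact j"
    by (intro tendsto_intros) auto
  then show ?thesis by (simp add: eq)
qed

lemma root_prob_tendsto: "root_prob d \<longlonglongrightarrow> mu d"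
proof -
  have "root_prob d = (\<lambda>q. \<Sum>j=1..d. (- 1) ^ (j - 1) * (real (q choose j) / real q ^ j))"
    by (simp add: root_prob_def fun_eq_iff)
  moreover have "\<dots> \<longlonglongrightarrow> (\<Sum>j=1..d. (- 1) ^ (j - 1) * (1 / fact j))"
    by (intro tendsto_intros choose_div_power_tendsto)
  ultimately show ?thesis by (simp add: mu_def)
qed

section \<open>Bounds for the mean search length by moments of the count\<close>

lemma inverse_count_le_second_moment:
  fixes N M p :: real
  assumes "N \<ge> 0" "M > 0" "p > 0"
  shows "(M + 1) / (N + 1) \<le> (M + 1) / (p * M / 2) + (M + 1) * (N - p * M)\<^sup>2 / (p * M / 2)\<^sup>2"
proof -
  have pM: "p * M / 2 > 0" and N1: "N + 1 > 0" using assms by simp_all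
  show ?thesis
  proof (cases "N \<ge> p * M / 2")
    case True
    then have "(M + 1) / (N + 1) \<le> (M + 1) / (p * M / 2)"
      using assms pM N1 by (intro divide_left_mono mult_pos_pos) auto
    moreover have "(M + 1) * (N - p * M)\<^sup>2 / (p * M / 2)\<^sup>2 \<ge> 0" using assms by simp
    ultimately show ?thesis by linarith
  next
    \<comment> \<open>Below half its mean, \<open>N\<close> deviates by at least
      \<open>p * M / 2\<close>. The quotient in the second summand is then at least 1 and pays for
      the trivial bound \<open>M + 1\<close>.\<close>
    case False
    then have "p * M / 2 \<le> p * M - N" by linarith
    then have "(p * M / 2)\<^sup>2 \<le> (p * M - N)\<^sup>2" using pM by (intro power_mono) linarith+
    then have "1 \<le> (N - p * M)\<^sup>2 / (p * M / 2)\<^sup>2"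
      unfolding power2_commute[of N] using zero_less_power[OF pM, of 2]
      by (simp only: le_divide_eq_1_pos)
    then have "(M + 1) * 1 \<le> (M + 1) * ((N - p * M)\<^sup>2 / (p * M / 2)\<^sup>2)"
      using assms by (intro mult_left_mono) auto
    moreover have "(M + 1) / (N + 1) \<le> (M + 1) / 1"
      using assms N1 by (intro divide_left_mono mult_pos_pos) auto
    moreover have "(M + 1) / (p * M / 2) \<ge> 0" using assms by simp
    ultimately show ?thesis by simp
  qed
qed

text \<open>Three ranges of \<open>N\<close>, one summand each. From
  \<open>(1 - \<delta>) * p * M\<close> on, the main term suffices. Between
  \<open>M / (2 * D)\<close> and that value, the left side is at most
  \<open>(M + 1) * (2 * D / M)\<close>, weighted as in Chebyshev's inequality. Below
  \<open>M / (2 * D)\<close> only the trivial bound \<open>M + 1\<close> is left, weighted by the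
  fourth power of \<open>s\<close>. Small \<open>\<delta>\<close> brings the main term close to
  \<open>1 / p\<close>.\<close>

lemma inverse_count_le_moments:
  fixes N M p D \<delta> :: real
  assumes "N \<ge> 0" "M > 0" "p > 0" "D > 0" "0 < \<delta>" "\<delta> < 1" and s: "s \<le> N - M / D"
  shows "(M + 1) / (N + 1) \<le> (M + 1) / ((1 - \<delta>) * p * M)
    + (M + 1) * (2 * D / M) * ((N - p * M)\<^sup>2 / (\<delta> * p * M)\<^sup>2)
    + (M + 1) * (s ^ 4 / (M / (2 * D)) ^ 4)"
proof -
  have nonneg: "(M + 1) / ((1 - \<delta>) * p * M) \<ge> 0"
    "(M + 1) * (2 * D / M) * ((N - p * M)\<^sup>2 / (\<delta> * p * M)\<^sup>2) \<ge> 0"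
    "(M + 1) * (s ^ 4 / (M / (2 * D)) ^ 4) \<ge> 0"
    using assms by auto
  have N1: "N + 1 > 0" using assms(1) by simp
  consider "N \<ge> (1 - \<delta>) * p * M" | "N < (1 - \<delta>) * p * M" "N \<ge> M / (2 * D)" | "N < M / (2 * D)"
    by linarith
  then show ?thesis
  proof cases
    case 1
    have "(M + 1) / (N + 1) \<le> (M + 1) / ((1 - \<delta>) * p * M)"
      using assms N1 1 by (intro divide_left_mono mult_pos_pos) auto
    with nonneg show ?thesis by linarith
  next
    case 2
    have "\<delta> * p * M \<le> p * M - N" using 2(1) by (simp add: left_diff_distrib)
    then have "(\<delta> * p * M)\<^sup>2 \<le> (p * M - N)\<^sup>2"
      using assms by (intro power_mono) auto
    moreover have "0 < (\<delta> * p * M)\<^sup>2" using assms by simp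
    ultimately have ge: "1 \<le> (N - p * M)\<^sup>2 / (\<delta> * p * M)\<^sup>2"
      unfolding power2_commute[of N] by (simp only: le_divide_eq_1_pos)
    have "(M + 1) / (N + 1) \<le> (M + 1) / (M / (2 * D))"
      using assms N1 2 by (intro divide_left_mono mult_pos_pos) auto
    also have "\<dots> = (M + 1) * (2 * D / M) * 1" by simp
    also have "\<dots> \<le> (M + 1) * (2 * D / M) * ((N - p * M)\<^sup>2 / (\<delta> * p * M)\<^sup>2)"
      using assms ge by (intro mult_left_mono) auto
    finally show ?thesis using nonneg by linarith
  next
    case 3
    \<comment> \<open>From \<open>s \<le> N - M / D\<close> and \<open>N < M / (2 * D)\<close> it
      follows that \<open>s\<close> lies below \<open>- M / (2 * D)\<close>, so its fourth power is
      large.\<close>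
    have "M / D = M / (2 * D) + M / (2 * D)" by simp
    then have "M / (2 * D) \<le> - s" using s 3 by linarith
    then have "(M / (2 * D)) ^ 4 \<le> (- s) ^ 4" using assms by (intro power_mono) auto
    moreover have "0 < (M / (2 * D)) ^ 4" using assms by simp
    ultimately have "1 \<le> s ^ 4 / (M / (2 * D)) ^ 4"
      by (simp only: le_divide_eq_1_pos power_minus_even even_numeral)
    then have "(M + 1) * 1 \<le> (M + 1) * (s ^ 4 / (M / (2 * D)) ^ 4)"
      using assms by (intro mult_left_mono) auto
    moreover have "(M + 1) / (N + 1) \<le> (M + 1) / 1"
      using assms N1 by (intro divide_left_mono mult_pos_pos) auto
    ultimately show ?thesis using nonneg by linarith
  qed
qed

text \<open>The first summand comes from the class with coefficient zero at the \<open>d\<close>-th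
  power of the last variable, whose share is \<open>1 / q\<close>. The others are the three summands
  of \<open>inverse_count_le_moments\<close> after averaging, estimated by means of
  \<open>M \<ge> q\<^sup>2\<close>.\<close>

definition search_bound :: "real \<Rightarrow> nat \<Rightarrow> nat \<Rightarrow> real" where
  "search_bound \<delta> d q = (8 * real d + 32 * real d ^ 2) / real q
    + (1 + 1 / real q) / ((1 - \<delta>) * root_prob d q)
    + 4 * real d / (\<delta>\<^sup>2 * (root_prob d q)\<^sup>2 * real q ^ 2)
    + 32 * real d ^ 4 * (real q + 1) / real q ^ 2"

lemma search_bound_tendsto:
  assumes "d \<ge> 2" "0 < \<delta>" "\<delta> < 1"
  shows "search_bound \<delta> d \<longlonglongrightarrow> 1 / ((1 - \<delta>) * mu d)"
proof -
  have mu: "mu d > 0" using mu_ge_half[OF assms(1)] by simp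
  have "(\<lambda>q. (8 * real d + 32 * real d ^ 2) / real q) \<longlonglongrightarrow> 0"
    by real_asymp
  moreover have "(\<lambda>q. (1 + 1 / real q) / ((1 - \<delta>) * root_prob d q)) \<longlonglongrightarrow> 1 / ((1 - \<delta>) * mu d)"
  proof (intro tendsto_divide tendsto_mult tendsto_const root_prob_tendsto)
    show "(\<lambda>q. 1 + 1 / real q) \<longlonglongrightarrow> 1" by real_asymp
  qed (use mu assms in auto)
  moreover have "(\<lambda>q. (4 * real d / (\<delta>\<^sup>2 * (root_prob d q)\<^sup>2)) * (1 / real q ^ 2))
      \<longlonglongrightarrow> (4 * real d / (\<delta>\<^sup>2 * (mu d)\<^sup>2)) * 0"
  proof (intro tendsto_divide tendsto_mult tendsto_const root_prob_tendsto tendsto_power)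
    show "(\<lambda>q. 1 / real q ^ 2) \<longlonglongrightarrow> 0" by real_asymp
  qed (use mu assms in auto)
  moreover have "(\<lambda>q. 32 * real d ^ 4 * ((real q + 1) / real q ^ 2)) \<longlonglongrightarrow> 32 * real d ^ 4 * 0"
  proof (intro tendsto_mult tendsto_const)
    show "(\<lambda>q. (real q + 1) / real q ^ 2) \<longlonglongrightarrow> 0" by real_asymp
  qed
  ultimately have "(\<lambda>q. (8 * real d + 32 * real d ^ 2) / real q
      + (1 + 1 / real q) / ((1 - \<delta>) * root_prob d q)
      + (4 * real d / (\<delta>\<^sup>2 * (root_prob d q)\<^sup>2)) * (1 / real q ^ 2)
      + 32 * real d ^ 4 * ((real q + 1) / real q ^ 2))
    \<longlonglongrightarrow> 0 + 1 / ((1 - \<delta>) * mu d) + (4 * real d / (\<delta>\<^sup>2 * (mu d)\<^sup>2)) * 0 + 32 * real d ^ 4 * 0"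
    by (intro tendsto_add)
  moreover have "search_bound \<delta> d = (\<lambda>q. (8 * real d + 32 * real d ^ 2) / real q
      + (1 + 1 / real q) / ((1 - \<delta>) * root_prob d q)
      + (4 * real d / (\<delta>\<^sup>2 * (root_prob d q)\<^sup>2)) * (1 / real q ^ 2)
      + 32 * real d ^ 4 * ((real q + 1) / real q ^ 2))"
    by (simp add: search_bound_def fun_eq_iff)
  ultimately show ?thesis by simp
qed

subsection \<open>Univariate polynomials over a finite field\<close>

locale finite_field = field +
  assumes finite_carrier: "finite (carrier R)"
begin

text \<open>The sum runs to a degree bound \<open>d\<close>, not to the degree of \<open>f\<close>.
  This makes evaluation additive in \<open>f\<close> even when leading coefficients cancel.\<close>

definition poly_eval :: "nat \<Rightarrow> (nat \<Rightarrow> 'a) \<Rightarrow> 'a \<Rightarrow> 'a" where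
  "poly_eval d f t = (\<Oplus>k\<in>{..d}. f k \<otimes> t [^] k)"

lemma poly_eval_closed [simp]:
  "(\<And>k. k \<le> d \<Longrightarrow> f k \<in> carrier R) \<Longrightarrow> t \<in> carrier R \<Longrightarrow> poly_eval d f t \<in> carrier R"
  unfolding poly_eval_def by (rule finsum_closed) auto

lemma poly_eval_cong:
  assumes "\<And>k. k \<le> d \<Longrightarrow> f k = g k" "\<And>k. k \<le> d \<Longrightarrow> g k \<in> carrier R" "t \<in> carrier R"
  shows "poly_eval d f t = poly_eval d g t"
  unfolding poly_eval_def using assms by (intro finsum_cong') auto

lemma poly_eval_add:
  assumes "\<And>k. k \<le> d \<Longrightarrow> f k \<in> carrier R" "\<And>k. k \<le> d \<Longrightarrow> g k \<in> carrier R" "t \<in> carrier R"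
  shows "poly_eval d (\<lambda>k. f k \<oplus> g k) t = poly_eval d f t \<oplus> poly_eval d g t"
proof -
  have "poly_eval d (\<lambda>k. f k \<oplus> g k) t = (\<Oplus>k\<in>{..d}. f k \<otimes> t [^] k \<oplus> g k \<otimes> t [^] k)"
    unfolding poly_eval_def using assms by (intro finsum_cong') (auto simp: l_distr)
  also have "\<dots> = poly_eval d f t \<oplus> poly_eval d g t"
    unfolding poly_eval_def using assms by (intro finsum_addf) auto
  finally show ?thesis .
qed

lemma poly_eval_monomial:
  assumes "j \<le> d" "c \<in> carrier R" "t \<in> carrier R"
  shows "poly_eval d (\<lambda>k. if k = j then c else \<zero>) t = c \<otimes> t [^] j"
proof -
  have "poly_eval d (\<lambda>k. if k = j then c else \<zero>) t = (\<Oplus>k\<in>{..d}. if j = k then c \<otimes> t [^] k else \<zero>)"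
    unfolding poly_eval_def using assms by (intro finsum_cong') auto
  also have "\<dots> = c \<otimes> t [^] j"
    using assms by (intro add.finprod_singleton) auto
  finally show ?thesis .
qed

lemma mem_UP:
  assumes "\<And>k. f k \<in> carrier R" "\<And>k. k > d \<Longrightarrow> f k = \<zero>"
  shows "f \<in> carrier (UP R)"
  unfolding UP_def using assms by (auto intro!: mem_upI exI[of _ d] bound.intro)

lemma eval_eq_poly_eval:
  assumes f: "\<And>k. f k \<in> carrier R" "\<And>k. k > d \<Longrightarrow> f k = \<zero>" and t: "t \<in> carrier R"
  shows "deg R f \<le> d" "UnivPoly.eval R R id t f = poly_eval d f t"
proof -
  have fU: "f \<in> carrier (UP R)" using mem_UP[OF f] .
  have coeff: "up_ring.coeff (UP R) f = f" using fU by (simp add: UP_def)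
  interpret U: UP_domain R "UP R" by unfold_locales
  show deg: "deg R f \<le> d"
    by (rule U.deg_aboveI[OF _ fU]) (simp only: coeff f(2))
  have "UnivPoly.eval R R id t f = (\<Oplus>i\<in>{..deg R f}. f i \<otimes> t [^] i)"
    using fU by (simp add: UnivPoly.eval_def coeff)
  also have "\<dots> = poly_eval d f t"
    unfolding poly_eval_def
  proof (rule add.finprod_mono_neutral_cong_left)
    fix i assume "i \<in> {..d} - {..deg R f}"
    then have "f i = \<zero>" using U.deg_aboveD[OF _ fU, of i] unfolding coeff by simp
    then show "f i \<otimes> t [^] i = \<zero>" using t by simp
  next
    show "(\<lambda>k. f k \<otimes> t [^] k) \<in> {..d} \<rightarrow> carrier R" using f(1) t by blast
  qed (use deg in simp_all)
  finally show "UnivPoly.eval R R id t f = poly_eval d f t" .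
qed

lemma card_roots_le:
  assumes f: "\<And>k. k \<le> d \<Longrightarrow> f k \<in> carrier R" and k: "k \<le> d" "f k \<noteq> \<zero>"
  shows "card {t \<in> carrier R. poly_eval d f t = \<zero>} \<le> d"
proof -
  interpret U: UP_domain R "UP R" by unfold_locales
  \<comment> \<open>The coefficients of \<open>f\<close> beyond \<open>d\<close> are arbitrary.
    Cutting them off gives an element of \<open>UP R\<close>, to which the root bound applies, and
    does not change the evaluation.\<close>
  define g where "g = (\<lambda>k. if k \<le> d then f k else \<zero>)"
  have g: "\<And>k. g k \<in> carrier R" "\<And>k. k > d \<Longrightarrow> g k = \<zero>" using f by (auto simp: g_def)
  have gU: "g \<in> carrier (UP R)" using mem_UP[OF g] .
  have "g \<noteq> \<zero>\<^bsub>UP R\<^esub>" using k by (auto simp: UP_def g_def fun_eq_iff)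
  then have "card {t \<in> carrier R. UnivPoly.eval R R id t g = \<zero>} \<le> deg R g"
    using U.roots_bound[OF gU _ finite_carrier] by simp
  also have "{t \<in> carrier R. UnivPoly.eval R R id t g = \<zero>} = {t \<in> carrier R. poly_eval d f t = \<zero>}"
  proof (rule Collect_cong, rule conj_cong[OF refl])
    fix t assume t: "t \<in> carrier R"
    have "poly_eval d g t = poly_eval d f t"
      using t f by (intro poly_eval_cong) (auto simp: g_def)
    then show "(UnivPoly.eval R R id t g = \<zero>) = (poly_eval d f t = \<zero>)"
      using eval_eq_poly_eval(2)[OF g t] by simp
  qed
  also have "deg R g \<le> d" using eval_eq_poly_eval(1)[OF g zero_closed] by simp
  finally show ?thesis .
qed

text \<open>Lagrange's theorem in the multiplicative group, with zero treated separately. It makes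
  every element of the field a root of \<open>frobenius_poly R\<close>.\<close>

lemma pow_order_eq:
  assumes "t \<in> carrier R"
  shows "t [^] order R = t"
proof (cases "t = \<zero>")
  case True
  then show ?thesis
    using finite_carrier nat_pow_zero[of "order R"] assms by (auto simp: order_def card_eq_0_iff)
next
  case False
  interpret M: group "Multiplicative_Group.mult_of R" by (rule field_mult_group)
  have "t [^]\<^bsub>Multiplicative_Group.mult_of R\<^esub> order (Multiplicative_Group.mult_of R) = \<one>"
    using M.pow_order_eq_1[of t] assms False by simp
  then have "t [^] (order R - 1) = \<one>"
    by (simp add: Multiplicative_Group.nat_pow_mult_of order_mult_of finite_carrier)
  moreover have "order R > 0" using finite_carrier assms by (auto simp: order_def card_gt_0_iff)
  then have "order R = Suc (order R - 1)" by simp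
  ultimately show ?thesis using assms by (metis l_one nat_pow_Suc)
qed

text \<open>A zero \<open>t\<close> makes X - t a common divisor: by the remainder theorem it
  divides every polynomial that vanishes at \<open>t\<close>, and \<open>frobenius_poly R\<close>
  vanishes everywhere. This direction is enough for an upper bound, since any further stop only
  shortens the search.\<close>

lemma not_gcd_is_one:
  assumes f: "\<And>k. strip_poly R r F a k \<in> carrier R" "\<And>k. k > d \<Longrightarrow> strip_poly R r F a k = \<zero>"
    and t: "t \<in> carrier R" "poly_eval d (strip_poly R r F a) t = \<zero>"
  shows "\<not> gcd_is_one R r F a"
proof
  interpret U: UP_domain R "UP R" by unfold_locales
  interpret E: UP_pre_univ_prop R R id "UP R" by unfold_locales auto
  let ?g = "up_ring.monom (UP R) \<one> 1 \<ominus>\<^bsub>UP R\<^esub> up_ring.monom (UP R) t 0"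
  have ntriv: "carrier R \<noteq> {\<zero>}" using one_not_zero one_closed by blast
  interpret h: ring_hom_cring "UP R" R "UnivPoly.eval R R id t"
    by unfold_locales (rule E.eval_ring_hom[OF t(1)])
  have gU: "?g \<in> carrier (UP R)" using t by simp
  have divides: "?g divides\<^bsub>UP R\<^esub> p" if p: "p \<in> carrier (UP R)" "UnivPoly.eval R R id t p = \<zero>" for p
  proof -
    obtain u v where "u \<in> carrier (UP R)" "p = ?g \<otimes>\<^bsub>UP R\<^esub> u \<oplus>\<^bsub>UP R\<^esub> up_ring.monom (UP R) \<zero> 0"
      using U.remainder_theorem[OF p(1) t(1) ntriv] p(2) by auto
    then have "p = ?g \<otimes>\<^bsub>UP R\<^esub> u" using gU by simp
    then show ?thesis using \<open>u \<in> _\<close> by (auto simp: factor_def)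
  qed
  assume "gcd_is_one R r F a"
  then have "\<And>y. y \<in> carrier (UP R) \<Longrightarrow> y divides\<^bsub>UP R\<^esub> strip_poly R r F a \<Longrightarrow>
      y divides\<^bsub>UP R\<^esub> frobenius_poly R \<Longrightarrow> y divides\<^bsub>UP R\<^esub> \<one>\<^bsub>UP R\<^esub>"
    unfolding gcd_is_one_def isgcd_def by blast
  moreover have "?g divides\<^bsub>UP R\<^esub> strip_poly R r F a"
    using mem_UP[OF f] eval_eq_poly_eval(2)[OF f t(1)] t(2) by (intro divides) auto
  moreover have "?g divides\<^bsub>UP R\<^esub> frobenius_poly R"
  proof (rule divides)
    show "frobenius_poly R \<in> carrier (UP R)" by (simp add: frobenius_poly_def)
    have "UnivPoly.eval R R id t (frobenius_poly R) = t [^] order R \<ominus> t"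
      using t(1) E.eval_monom[OF one_closed t(1)]
      by (simp add: frobenius_poly_def a_minus_def)
    then show "UnivPoly.eval R R id t (frobenius_poly R) = \<zero>"
      using t(1) pow_order_eq by simp
  qed
  ultimately have "?g divides\<^bsub>UP R\<^esub> \<one>\<^bsub>UP R\<^esub>" using gU by blast
  then obtain u where u: "u \<in> carrier (UP R)" "\<one>\<^bsub>UP R\<^esub> = ?g \<otimes>\<^bsub>UP R\<^esub> u"
    by (auto simp: factor_def)
  \<comment> \<open>Evaluation at \<open>t\<close> turns a factorization of 1 by X - t into
    \<open>\<one> = \<zero>\<close>.\<close>
  have "UnivPoly.eval R R id t (?g \<otimes>\<^bsub>UP R\<^esub> u) = \<zero>"
    using gU u(1) U.eval_monom_expr[OF t(1)] by simp
  then have "UnivPoly.eval R R id t \<one>\<^bsub>UP R\<^esub> = \<zero>" using u(2) by simp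
  then show False using h.hom_one by simp
qed

section \<open>Zeros of a random univariate polynomial with prescribed leading coefficient\<close>

lemma order_ge_2: "order R \<ge> 2"
proof -
  have "card {\<zero>, \<one>} \<le> card (carrier R)"
    using finite_carrier by (intro card_mono) auto
  then show ?thesis by (simp add: order_def)
qed

text \<open>Only the coefficients below \<open>d\<close> are recorded; the one at \<open>d\<close>
  is supplied as \<open>h(d := c)\<close>. Extensional functions make the representation unique, so
  the sample space has exactly \<open>order R ^ d\<close> elements.\<close>

definition coeffs :: "nat \<Rightarrow> (nat \<Rightarrow> 'a) set" where
  "coeffs d = {..<d} \<rightarrow>\<^sub>E carrier R"

lemma finite_coeffs [simp]: "finite (coeffs d)"
  using finite_carrier by (auto simp: coeffs_def intro: finite_PiE)

lemma card_coeffs: "card (coeffs d) = order R ^ d"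
  by (simp add: coeffs_def card_PiE order_def)

definition zeros :: "nat \<Rightarrow> 'a \<Rightarrow> (nat \<Rightarrow> 'a) \<Rightarrow> 'a set" where
  "zeros d c h = {t \<in> carrier R. poly_eval d (h(d := c)) t = \<zero>}"

lemma zeros_subset: "zeros d c h \<subseteq> carrier R"
  by (auto simp: zeros_def)

lemma finite_zeros [simp]: "finite (zeros d c h)"
  using zeros_subset finite_carrier by (rule finite_subset)

lemma coeffs_upd_closed: "h \<in> coeffs d \<Longrightarrow> c \<in> carrier R \<Longrightarrow> k \<le> d \<Longrightarrow> (h(d := c)) k \<in> carrier R"
  unfolding coeffs_def using PiE_mem[of h "{..<d}" "\<lambda>_. carrier R" k] by (cases "k = d") simp_all

lemma card_zeros_le:
  assumes "h \<in> coeffs d" "c \<in> carrier R" "k \<le> d" "(h(d := c)) k \<noteq> \<zero>"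
  shows "card (zeros d c h) \<le> d"
  unfolding zeros_def using assms coeffs_upd_closed by (intro card_roots_le) blast+

text \<open>Lagrange interpolation: evaluation at \<open>d\<close> points is injective on \<open>coeffs d\<close>, hence bijective.\<close>

lemma card_vanishing:
  assumes J: "J \<subseteq> carrier R" "card J \<le> d" and d: "0 < d" "d \<le> order R" and c: "c \<in> carrier R"
  shows "card {h \<in> coeffs d. J \<subseteq> zeros d c h} = order R ^ (d - card J)"
proof -
  have finJ: "finite J" using J finite_carrier finite_subset by blast
  \<comment> \<open>\<open>J\<close> is enlarged to a set of \<open>d\<close> interpolation nodes,
    which is where \<open>d \<le> order R\<close> enters.\<close>
  obtain I where I: "J \<subseteq> I" "I \<subseteq> carrier R" "card I = d"
    using exists_subset_between[OF J(2) _ J(1) finite_carrier, of] d by (auto simp: order_def)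
  have finI: "finite I" using I finite_carrier finite_subset by blast
  define \<Phi> where "\<Phi> = (\<lambda>h. \<lambda>t\<in>I. poly_eval d (h(d := c)) t)"
  have inj: "inj_on \<Phi> (coeffs d)"
  proof (rule inj_onI, rule ccontr)
    fix h h' assume h: "h \<in> coeffs d" "h' \<in> coeffs d" and eq: "\<Phi> h = \<Phi> h'" and "h \<noteq> h'"
    \<comment> \<open>Both polynomials have the coefficient \<open>c\<close> at \<open>d\<close>, so
      their difference has degree at most \<open>d - 1\<close>. Being nonzero, it cannot vanish at
      all \<open>d\<close> nodes.\<close>
    define f where "f = (\<lambda>k. (h(d := c)) k \<ominus> (h'(d := c)) k)"
    have cl: "(h(d := c)) k \<in> carrier R" "(h'(d := c)) k \<in> carrier R" if "k \<le> d" for k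
      using h c that coeffs_upd_closed by blast+
    have f: "f k \<in> carrier R" if "k \<le> d" for k using cl[OF that] by (simp add: f_def)
    obtain k where k: "k < d" "h k \<noteq> h' k"
      using h \<open>h \<noteq> h'\<close> unfolding coeffs_def by (metis PiE_ext lessThan_iff)
    have "I \<subseteq> {t \<in> carrier R. poly_eval (d - 1) f t = \<zero>}"
    proof
      fix t assume t: "t \<in> I"
      then have tR: "t \<in> carrier R" using I by auto
      have "poly_eval d (h(d := c)) t = poly_eval d (\<lambda>k. f k \<oplus> (h'(d := c)) k) t"
        using cl tR unfolding f_def
        by (intro poly_eval_cong) (auto simp: a_minus_def a_assoc l_neg)
      also have "\<dots> = poly_eval d f t \<oplus> poly_eval d (h'(d := c)) t"
        using cl f tR by (intro poly_eval_add) auto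
      also have "poly_eval d (h'(d := c)) t = poly_eval d (h(d := c)) t"
        using fun_cong[OF eq, of t] t by (simp add: \<Phi>_def)
      finally have "poly_eval d f t \<oplus> poly_eval d (h(d := c)) t = poly_eval d (h(d := c)) t"
        by (rule sym)
      then have 0: "poly_eval d f t = \<zero>"
        using add.r_cancel_one[of "poly_eval d (h(d := c)) t" "poly_eval d f t"]
          poly_eval_closed[of d f t] poly_eval_closed[of d "h(d := c)" t] f cl(1) tR by blast
      have "poly_eval (Suc (d - 1)) f t = f (Suc (d - 1)) \<otimes> t [^] Suc (d - 1) \<oplus> poly_eval (d - 1) f t"
        unfolding poly_eval_def using f tR d by (intro finsum_Suc) auto
      moreover have "f d = \<zero>" using c by (simp add: f_def)
      ultimately have "poly_eval (d - 1) f t = \<zero>"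
        using 0 d f tR by simp
      then show "t \<in> {t \<in> carrier R. poly_eval (d - 1) f t = \<zero>}" using tR by simp
    qed
    then have "card I \<le> card {t \<in> carrier R. poly_eval (d - 1) f t = \<zero>}"
      using finite_carrier by (intro card_mono) auto
    also have "\<dots> \<le> d - 1"
      using k f cl[of k] by (intro card_roots_le[where k = k]) (auto simp: f_def)
    finally show False using I d by simp
  qed
  have sub: "\<Phi> ` coeffs d \<subseteq> I \<rightarrow>\<^sub>E carrier R"
    using I c coeffs_upd_closed by (auto simp: \<Phi>_def intro!: poly_eval_closed)
  have surj: "\<Phi> ` coeffs d = I \<rightarrow>\<^sub>E carrier R"
    using finI finite_carrier sub
    by (intro card_subset_eq) (auto simp: card_image[OF inj] card_coeffs card_PiE I order_def intro!: finite_PiE)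
  have "card {h \<in> coeffs d. J \<subseteq> zeros d c h} = card (\<Phi> ` {h \<in> coeffs d. J \<subseteq> zeros d c h})"
    by (intro card_image[symmetric] inj_on_subset[OF inj]) auto
  \<comment> \<open>In terms of the values at the nodes, vanishing on \<open>J\<close> prescribes
    zero there and leaves the other \<open>d - card J\<close> values free.\<close>
  also have "\<Phi> ` {h \<in> coeffs d. J \<subseteq> zeros d c h} = Pi\<^sub>E I (\<lambda>t. if t \<in> J then {\<zero>} else carrier R)"
    (is "?l = ?r")
  proof
    show "?l \<subseteq> ?r"
    proof
      fix g assume "g \<in> ?l"
      then obtain h where h: "h \<in> coeffs d" "J \<subseteq> zeros d c h" "g = \<Phi> h" by blast
      then have g: "g \<in> I \<rightarrow>\<^sub>E carrier R" using sub by blast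
      have "g t = \<zero>" if "t \<in> J" for t
        using h that I(1) by (auto simp: \<Phi>_def zeros_def)
      then show "g \<in> ?r" using g by (intro PiE_I) (simp_all add: PiE_mem[OF g] PiE_arb[OF g])
    qed
    show "?r \<subseteq> ?l"
    proof
      fix g assume g: "g \<in> ?r"
      then have "g \<in> I \<rightarrow>\<^sub>E carrier R" by (rule subsetD[OF PiE_mono, rotated]) simp
      then obtain h where h: "h \<in> coeffs d" "g = \<Phi> h" using surj by blast
      have "J \<subseteq> zeros d c h"
      proof
        fix t assume t: "t \<in> J"
        then have "g t = \<zero>" using PiE_mem[OF g, of t] I by auto
        then show "t \<in> zeros d c h" using t I h by (auto simp: zeros_def \<Phi>_def)
      qed
      then show "g \<in> ?l" using h by blast
    qed
  qed
  also have "card \<dots> = (\<Prod>t\<in>I. if t \<in> J then 1 else order R)"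
    using finI by (subst card_PiE) (auto intro!: prod.cong simp: order_def)
  also have "\<dots> = order R ^ card (I - J)"
    using finI I(1) by (subst prod.If_cases) (auto intro!: arg_cong[where f = card] simp: Diff_eq)
  also have "card (I - J) = d - card J"
    using I finJ by (simp add: card_Diff_subset)
  finally show ?thesis .
qed

definition rooted :: "nat \<Rightarrow> 'a \<Rightarrow> (nat \<Rightarrow> 'a) set" where
  "rooted d c = {h \<in> coeffs d. zeros d c h \<noteq> {}}"

text \<open>Double counting of the pairs of a polynomial and a \<open>j\<close>-subset of its
  zeros.\<close>

lemma sum_choose_zeros:
  assumes "j \<le> d" "0 < d" "d \<le> order R" "c \<in> carrier R"
  shows "(\<Sum>h\<in>coeffs d. card (zeros d c h) choose j) = (order R choose j) * order R ^ (d - j)"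
proof -
  let ?\<J> = "{J. J \<subseteq> carrier R \<and> card J = j}"
  have fin: "finite ?\<J>" using finite_carrier by simp
  have "(\<Sum>h\<in>coeffs d. card (zeros d c h) choose j) = (\<Sum>h\<in>coeffs d. card {J \<in> ?\<J>. J \<subseteq> zeros d c h})"
  proof (rule sum.cong[OF refl])
    fix h
    have "{J \<in> ?\<J>. J \<subseteq> zeros d c h} = {J. J \<subseteq> zeros d c h \<and> card J = j}"
      using zeros_subset by blast
    then show "card (zeros d c h) choose j = card {J \<in> ?\<J>. J \<subseteq> zeros d c h}"
      using n_subsets[OF finite_zeros] by simp
  qed
  also have "\<dots> = (\<Sum>h\<in>coeffs d. \<Sum>J\<in>?\<J>. of_bool (J \<subseteq> zeros d c h))"
    by (intro sum.cong refl card_filter_eq_sum[OF fin, where 'c = nat, simplified of_nat_id])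
  also have "\<dots> = (\<Sum>J\<in>?\<J>. \<Sum>h\<in>coeffs d. of_bool (J \<subseteq> zeros d c h))"
    by (rule sum.swap)
  also have "\<dots> = (\<Sum>J\<in>?\<J>. card {h \<in> coeffs d. J \<subseteq> zeros d c h})"
    by (intro sum.cong refl card_filter_eq_sum[OF finite_coeffs, where 'c = nat, simplified of_nat_id, symmetric])
  also have "\<dots> = (\<Sum>J\<in>?\<J>. order R ^ (d - j))"
    using assms by (intro sum.cong refl) (auto simp: card_vanishing)
  also have "\<dots> = (order R choose j) * order R ^ (d - j)"
    using n_subsets[OF finite_carrier, of j] by (simp add: order_def)
  finally show ?thesis .
qed

text \<open>As \<open>c \<noteq> \<zero>\<close>, there are at most \<open>d\<close> zeros, so the
  alternating sum truncated at \<open>d\<close> is exactly the indicator of having a zero.\<close>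

lemma card_rooted:
  assumes "0 < d" "d \<le> order R" "c \<in> carrier R" "c \<noteq> \<zero>"
  shows "real (card (rooted d c)) =
    (\<Sum>j=1..d. (- 1) ^ (j - 1) * real ((order R choose j) * order R ^ (d - j)))"
proof -
  have "real (card (rooted d c)) = (\<Sum>h\<in>coeffs d. of_bool (card (zeros d c h) > 0))"
    unfolding rooted_def card_filter_eq_sum[OF finite_coeffs]
    by (intro sum.cong refl) (simp add: card_gt_0_iff)
  also have "\<dots> = (\<Sum>h\<in>coeffs d. \<Sum>j=1..d. (- 1) ^ (j - 1) * real (card (zeros d c h) choose j))"
  proof (rule sum.cong[OF refl])
    fix h assume "h \<in> coeffs d"
    then have "card (zeros d c h) \<le> d"
      using assms by (intro card_zeros_le[where k = d]) auto
    from alternating_choose_sum[OF this]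
    show "of_bool (card (zeros d c h) > 0) = (\<Sum>j=1..d. (- 1) ^ (j - 1) * real (card (zeros d c h) choose j))"
      by simp
  qed
  also have "\<dots> = (\<Sum>j=1..d. (- 1) ^ (j - 1) * real (\<Sum>h\<in>coeffs d. card (zeros d c h) choose j))"
    by (subst sum.swap) (simp add: sum_distrib_left)
  also have "\<dots> = (\<Sum>j=1..d. (- 1) ^ (j - 1) * real ((order R choose j) * order R ^ (d - j)))"
    using assms by (intro sum.cong refl arg_cong2[where f = "(*)"] arg_cong[where f = real] sum_choose_zeros) auto
  finally show ?thesis .
qed

text \<open>The mean number of zeros is 1. The zero polynomial accounts for \<open>order R\<close>
  zeros and every other one for at most \<open>d\<close>, hence
  \<open>order R ^ d \<le> order R + d * card (rooted d \<zero>)\<close>. Because of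
  \<open>2 * order R \<le> order R ^ d\<close> the first summand takes at most half.\<close>

lemma card_rooted_zero_ge:
  assumes d: "2 \<le> d" "d \<le> order R"
  shows "order R ^ d \<le> 2 * d * card (rooted d \<zero>)"
proof -
  define z where "z = (\<lambda>k\<in>{..<d}. \<zero>)"
  have "order R ^ d = (\<Sum>h\<in>coeffs d. card (zeros d \<zero> h))"
    using sum_choose_zeros[of 1 d \<zero>] d by (cases d) (auto simp flip: power_Suc)
  also have "\<dots> \<le> (\<Sum>h\<in>coeffs d. (if h = z then order R else 0) + (if h \<in> rooted d \<zero> then d else 0))"
  proof (rule sum_mono)
    fix h assume h: "h \<in> coeffs d"
    consider "h = z" | "h \<notin> rooted d \<zero>" | "h \<noteq> z" "h \<in> rooted d \<zero>" by blast
    then show "card (zeros d \<zero> h) \<le> (if h = z then order R else 0) + (if h \<in> rooted d \<zero> then d else 0)"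
    proof cases
      case 1
      have "card (zeros d \<zero> h) \<le> order R"
        unfolding order_def using finite_carrier zeros_subset by (rule card_mono)
      with 1 show ?thesis by simp
    next
      case 2
      then show ?thesis using h by (simp add: rooted_def)
    next
      case 3
      have "\<exists>k<d. h k \<noteq> \<zero>"
      proof (rule ccontr)
        assume "\<not> ?thesis"
        then have "h = z" using h by (intro PiE_ext[of h "{..<d}" "\<lambda>_. carrier R" z])
          (auto simp: z_def coeffs_def)
        then show False using 3 by simp
      qed
      then obtain k where "k < d" "h k \<noteq> \<zero>" by blast
      then have "card (zeros d \<zero> h) \<le> d"
        using h by (intro card_zeros_le[where k = k]) auto
      then show ?thesis using 3 by simp
    qed
  qed
  also have "\<dots> = order R + d * card (rooted d \<zero>)"
  proof -
    have "z \<in> coeffs d" by (auto simp: z_def coeffs_def)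
    moreover have "coeffs d \<inter> rooted d \<zero> = rooted d \<zero>" by (auto simp: rooted_def)
    ultimately show ?thesis by (simp add: sum.distrib flip: sum.inter_restrict)
  qed
  finally have "order R ^ d \<le> order R + d * card (rooted d \<zero>)" .
  moreover have "2 * order R \<le> order R ^ d"
  proof -
    have "2 * order R \<le> order R ^ 2" using order_ge_2 by (simp add: power2_eq_square)
    also have "\<dots> \<le> order R ^ d" using d order_ge_2 by (intro power_increasing) auto
    finally show ?thesis .
  qed
  ultimately show ?thesis by linarith
qed

subsection \<open>Strip polynomials\<close>

text \<open>The value of a monomial at \<open>a\<close> with the last variable set to 1; that
  variable remains as the indeterminate of the strip polynomial.\<close>

definition strip_monom :: "nat \<Rightarrow> 'a list \<Rightarrow> nat multiset \<Rightarrow> 'a" where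
  "strip_monom r a m = (\<Otimes>i\<in>{..<r - 1}. (a ! i) [^] count m i)"

lemma affine_space_nth: "a \<in> affine_space R n \<Longrightarrow> i < n \<Longrightarrow> a ! i \<in> carrier R"
  unfolding affine_space_def using nth_mem by blast

lemma strip_monom_closed [simp]: "a \<in> affine_space R (r - 1) \<Longrightarrow> strip_monom r a m \<in> carrier R"
  unfolding strip_monom_def by (rule finprod_closed) (auto intro: affine_space_nth)

lemma strip_monom_add_mset:
  assumes "a \<in> affine_space R (r - 1)" "i < r - 1"
  shows "strip_monom r a (add_mset i m) = a ! i \<otimes> strip_monom r a m"
proof -
  have nth: "a ! k \<in> carrier R" if "k < r - 1" for k
    using assms(1) that by (rule affine_space_nth)
  have "strip_monom r a (add_mset i m) =
      (\<Otimes>k\<in>{..<r - 1}. (if i = k then a ! k else \<one>) \<otimes> (a ! k) [^] count m k)"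
    unfolding strip_monom_def using assms
    by (intro finprod_cong') (auto simp: nth m_comm)
  also have "\<dots> = (\<Otimes>k\<in>{..<r - 1}. if i = k then a ! k else \<one>) \<otimes> strip_monom r a m"
    unfolding strip_monom_def using assms
    by (intro finprod_multf) (auto simp: nth)
  also have "(\<Otimes>k\<in>{..<r - 1}. if i = k then a ! k else \<one>) = a ! i"
    using assms by (intro finprod_singleton) (auto simp: nth)
  finally show ?thesis .
qed

lemma strip_monom_add_mset_last:
  assumes "a \<in> affine_space R (r - 1)"
  shows "strip_monom r a (add_mset (r - 1) m) = strip_monom r a m"
  unfolding strip_monom_def using affine_space_nth[OF assms] by (intro finprod_cong') auto

lemma mpolysD:
  assumes "F \<in> mpolys R r e"
  shows "F m \<in> carrier R" "F m \<noteq> \<zero> \<Longrightarrow> m \<in> monomials r e"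
proof -
  have F: "F \<in> indexed_pset {..<r} (carrier R)" "\<And>m. F m \<noteq> \<zero> \<Longrightarrow> size m \<le> e"
    using assms by (auto simp: mpolys_def)
  show "F m \<in> carrier R"
    using indexed_pset_in_carrier[OF subset_refl F(1)] by (simp add: carrier_coeff_def)
  have "F m \<noteq> \<zero> \<longrightarrow> set_mset m \<subseteq> {..<r}" for m
    using F(1)
  proof (induction arbitrary: m)
    case (indexed_const k)
    then show ?case by (simp add: indexed_const_def)
  next
    case (indexed_padd P Q)
    have "P m \<noteq> \<zero> \<or> Q m \<noteq> \<zero>" if "indexed_padd P Q m \<noteq> \<zero>"
      using that by (auto simp: indexed_padd_def)
    then show ?case using indexed_padd.IH by blast
  next
    case (indexed_pmult P i)
    show ?case
    proof
      assume "indexed_pmult P i m \<noteq> \<zero>"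
      then have i: "i \<in># m" and "P (m - {#i#}) \<noteq> \<zero>" by (auto simp: indexed_pmult_def split: if_splits)
      then have "set_mset (m - {#i#}) \<subseteq> {..<r}" using indexed_pmult.IH by blast
      moreover have "set_mset m = insert i (set_mset (m - {#i#}))"
        using i by (metis insert_DiffM set_mset_add_mset_insert)
      ultimately show "set_mset m \<subseteq> {..<r}" using indexed_pmult.hyps by simp
    qed
  qed
  then show "F m \<noteq> \<zero> \<Longrightarrow> m \<in> monomials r e" using F(2) by (simp add: monomials_def)
qed

lemma finite_mpolys [simp]: "finite (mpolys R r e)"
proof (rule finite_subset)
  let ?G = "\<lambda>f m. if m \<in> monomials r e then f m else \<zero>"
  show "mpolys R r e \<subseteq> ?G ` (monomials r e \<rightarrow>\<^sub>E carrier R)"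
  proof
    fix F assume F: "F \<in> mpolys R r e"
    have "F = ?G (restrict F (monomials r e))"
      using mpolysD(2)[OF F] by (auto simp: fun_eq_iff)
    moreover have "restrict F (monomials r e) \<in> monomials r e \<rightarrow>\<^sub>E carrier R"
      using mpolysD(1)[OF F] by (simp add: restrict_PiE_iff)
    ultimately show "F \<in> ?G ` (monomials r e \<rightarrow>\<^sub>E carrier R)" by (rule image_eqI)
  qed
  show "finite (?G ` (monomials r e \<rightarrow>\<^sub>E carrier R))"
    using finite_carrier by (intro finite_imageI finite_PiE) auto
qed

lemma mpolys_mono: "e \<le> e' \<Longrightarrow> mpolys R r e \<subseteq> mpolys R r e'"
  unfolding mpolys_def using le_trans by blast

lemma const_mem_mpolys:
  assumes "c \<in> carrier R"
  shows "indexed_const c \<in> mpolys R r e"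
  using indexed_pset.indexed_const[OF assms] by (auto simp: mpolys_def indexed_const_def)

lemma padd_mem_mpolys:
  assumes F: "F \<in> mpolys R r e" and G: "G \<in> mpolys R r e"
  shows "indexed_padd F G \<in> mpolys R r e"
proof -
  have "indexed_padd F G \<in> indexed_pset {..<r} (carrier R)"
    using assms by (intro indexed_pset.indexed_padd) (auto simp: mpolys_def)
  moreover have "size m \<le> e" if "indexed_padd F G m \<noteq> \<zero>" for m
  proof -
    have "F m \<noteq> \<zero> \<or> G m \<noteq> \<zero>" using that by (auto simp: indexed_padd_def)
    then show ?thesis using F G by (auto simp: mpolys_def)
  qed
  ultimately show ?thesis by (simp add: mpolys_def)
qed

lemma pmult_mem_mpolys:
  assumes F: "F \<in> mpolys R r e" and i: "i < r"
  shows "indexed_pmult F i \<in> mpolys R r (Suc e)"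
proof -
  have "indexed_pmult F i \<in> indexed_pset {..<r} (carrier R)"
    using assms by (intro indexed_pset.indexed_pmult) (auto simp: mpolys_def)
  moreover have "size m \<le> Suc e" if "indexed_pmult F i m \<noteq> \<zero>" for m
  proof -
    have "i \<in># m" "F (m - {#i#}) \<noteq> \<zero>" using that by (auto simp: indexed_pmult_def split: if_splits)
    moreover from this have "size (m - {#i#}) \<le> e" using F by (simp add: mpolys_def)
    ultimately show ?thesis by (simp add: size_Diff_singleton)
  qed
  ultimately show ?thesis by (simp add: mpolys_def)
qed

text \<open>Scaling is not among the generating operations of \<open>indexed_pset\<close>, so it is
  pushed through them by induction.\<close>

lemma scale_mem_mpolys:
  assumes F: "F \<in> mpolys R r e" and c: "c \<in> carrier R"
  shows "(\<lambda>m. c \<otimes> F m) \<in> mpolys R r e"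
proof -
  have "(\<lambda>m. c \<otimes> F m) \<in> indexed_pset {..<r} (carrier R)"
    if "F \<in> indexed_pset {..<r} (carrier R)" for F
    using that
  proof induction
    case (indexed_const k)
    have eq: "(\<lambda>m. c \<otimes> indexed_const k m) = indexed_const (c \<otimes> k)"
      using c by (auto simp: indexed_const_def)
    show ?case unfolding eq using c indexed_const by (intro indexed_pset.indexed_const) simp
  next
    case (indexed_padd P Q)
    then have "P m \<in> carrier R" "Q m \<in> carrier R" for m
      using indexed_pset_in_carrier[OF subset_refl] by (auto simp: carrier_coeff_def)
    then have eq: "(\<lambda>m. c \<otimes> indexed_padd P Q m) = indexed_padd (\<lambda>m. c \<otimes> P m) (\<lambda>m. c \<otimes> Q m)"
      using c by (auto simp: indexed_padd_def r_distr)
    show ?case unfolding eq by (intro indexed_pset.indexed_padd indexed_padd.IH)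
  next
    case (indexed_pmult P i)
    have eq: "(\<lambda>m. c \<otimes> indexed_pmult P i m) = indexed_pmult (\<lambda>m. c \<otimes> P m) i"
      using c by (auto simp: indexed_pmult_def)
    show ?case unfolding eq by (intro indexed_pset.indexed_pmult indexed_pmult.IH indexed_pmult.hyps)
  qed
  moreover have "size m \<le> e" if "c \<otimes> F m \<noteq> \<zero>" for m
    using F c that by (cases "F m = \<zero>") (auto simp: mpolys_def)
  ultimately show ?thesis using F by (simp add: mpolys_def)
qed

abbreviation slice :: "nat \<Rightarrow> nat \<Rightarrow> nat \<Rightarrow> nat multiset set" where
  "slice r e j \<equiv> {m \<in> monomials r e. count m (r - 1) = j}"

text \<open>Replaces the support of \<open>F\<close> by an index set that is the same for all
  polynomials of degree at most \<open>e\<close>, so that strip coefficients of different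
  polynomials can be combined termwise.\<close>

lemma strip_poly_eq:
  assumes F: "F \<in> mpolys R r e" and a: "a \<in> affine_space R (r - 1)"
  shows "strip_poly R r F a j = (\<Oplus>m\<in>slice r e j. F m \<otimes> strip_monom r a m)"
  unfolding strip_poly_def strip_monom_def[symmetric]
  using mpolysD[OF F] a by (intro add.finprod_mono_neutral_cong_left) auto

lemma strip_poly_closed:
  assumes "F \<in> mpolys R r e" "a \<in> affine_space R (r - 1)"
  shows "strip_poly R r F a j \<in> carrier R"
  unfolding strip_poly_eq[OF assms] using mpolysD(1)[OF assms(1)] assms(2)
  by (intro finsum_closed) auto

lemma strip_poly_above:
  assumes "F \<in> mpolys R r e" "a \<in> affine_space R (r - 1)" "j > e"
  shows "strip_poly R r F a j = \<zero>"
proof -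
  have "count m (r - 1) \<noteq> j" if "m \<in> monomials r e" for m
    using that assms(3) count_le_size[of m "r - 1"] by (simp add: monomials_def)
  then have "slice r e j = {}" by blast
  then show ?thesis unfolding strip_poly_eq[OF assms(1,2)] by (simp only: finsum_empty)
qed

text \<open>Only the pure power of the last variable contributes, so the top coefficient is the same
  in all strips. This allows conditioning on it for all strips at once.\<close>

lemma strip_poly_top:
  assumes F: "F \<in> mpolys R r e" and a: "a \<in> affine_space R (r - 1)" and r: "r > 0"
  shows "strip_poly R r F a e = F (replicate_mset e (r - 1))"
proof -
  have "slice r e e = {replicate_mset e (r - 1)}"
    using r by (auto simp: monomials_def split: if_splits intro!: count_eq_size_imp_replicate)
  moreover have "strip_monom r a (replicate_mset e (r - 1)) = \<one>"
    unfolding strip_monom_def by (intro finprod_one_eqI) auto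
  ultimately show ?thesis
    unfolding strip_poly_eq[OF F a] using mpolysD(1)[OF F] by simp
qed

lemma strip_poly_padd:
  assumes F: "F \<in> mpolys R r e" and G: "G \<in> mpolys R r e" and a: "a \<in> affine_space R (r - 1)"
  shows "strip_poly R r (indexed_padd F G) a j = strip_poly R r F a j \<oplus> strip_poly R r G a j"
proof -
  have "strip_poly R r (indexed_padd F G) a j =
      (\<Oplus>m\<in>slice r e j. F m \<otimes> strip_monom r a m \<oplus> G m \<otimes> strip_monom r a m)"
    unfolding strip_poly_eq[OF padd_mem_mpolys[OF F G] a]
    using mpolysD(1)[OF F] mpolysD(1)[OF G] a
    by (intro finsum_cong') (auto simp: indexed_padd_def l_distr)
  also have "\<dots> = strip_poly R r F a j \<oplus> strip_poly R r G a j"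
    unfolding strip_poly_eq[OF F a] strip_poly_eq[OF G a]
    using mpolysD(1)[OF F] mpolysD(1)[OF G] a by (intro finsum_addf) auto
  finally show ?thesis .
qed

lemma strip_poly_scale:
  assumes F: "F \<in> mpolys R r e" and c: "c \<in> carrier R" and a: "a \<in> affine_space R (r - 1)"
  shows "strip_poly R r (\<lambda>m. c \<otimes> F m) a j = c \<otimes> strip_poly R r F a j"
proof -
  have "strip_poly R r (\<lambda>m. c \<otimes> F m) a j = (\<Oplus>m\<in>slice r e j. c \<otimes> (F m \<otimes> strip_monom r a m))"
    unfolding strip_poly_eq[OF scale_mem_mpolys[OF F c] a]
    using mpolysD(1)[OF F] a c by (intro finsum_cong') (auto simp: m_assoc)
  also have "\<dots> = c \<otimes> strip_poly R r F a j"
    unfolding strip_poly_eq[OF F a]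
    using mpolysD(1)[OF F] a c by (intro finsum_rdistr[symmetric]) auto
  finally show ?thesis .
qed

lemma strip_poly_const:
  assumes c: "c \<in> carrier R" and a: "a \<in> affine_space R (r - 1)" and r: "r > 0"
  shows "strip_poly R r (indexed_const c) a j = (if j = 0 then c else \<zero>)"
  using strip_poly_top[OF const_mem_mpolys[OF c, of r 0] a r]
    strip_poly_above[OF const_mem_mpolys[OF c, of r 0] a, of j]
  by (auto simp: indexed_const_def)

text \<open>Multiplication by a variable shifts the support along the injection
  \<open>add_mset i\<close>, so the sum is reindexed. The cases of a horizontal variable and of the
  last one are specialized afterwards.\<close>

lemma strip_poly_pmult:
  assumes F: "F \<in> mpolys R r e" and i: "i < r" and a: "a \<in> affine_space R (r - 1)"
  shows "strip_poly R r (indexed_pmult F i) a j =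
    (\<Oplus>m\<in>{m \<in> monomials r e. count (add_mset i m) (r - 1) = j}. F m \<otimes> strip_monom r a (add_mset i m))"
proof -
  let ?A = "{m \<in> monomials r e. count (add_mset i m) (r - 1) = j}"
  have F': "indexed_pmult F i m \<in> carrier R" for m
    using mpolysD(1)[OF pmult_mem_mpolys[OF F i]] .
  have "strip_poly R r (indexed_pmult F i) a j =
      (\<Oplus>m\<in>add_mset i ` ?A. indexed_pmult F i m \<otimes> strip_monom r a m)"
    unfolding strip_poly_eq[OF pmult_mem_mpolys[OF F i] a]
  proof (rule add.finprod_mono_neutral_cong_right)
    show "add_mset i ` ?A \<subseteq> slice r (Suc e) j"
      using i by (auto simp: monomials_def)
    fix m assume m: "m \<in> slice r (Suc e) j - add_mset i ` ?A"
    have "indexed_pmult F i m = \<zero>"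
    proof (rule ccontr)
      assume "indexed_pmult F i m \<noteq> \<zero>"
      then have "i \<in># m" "F (m - {#i#}) \<noteq> \<zero>" by (auto simp: indexed_pmult_def split: if_splits)
      then have "m = add_mset i (m - {#i#})" "m - {#i#} \<in> monomials r e"
        using mpolysD(2)[OF F] by auto
      then obtain m' where m': "m = add_mset i m'" "m' \<in> monomials r e" by blast
      then have "m \<in> add_mset i ` ?A" using m by blast
      then show False using m by simp
    qed
    then show "indexed_pmult F i m \<otimes> strip_monom r a m = \<zero>" using a by simp
  qed (use F' a in auto)
  also have "\<dots> = (\<Oplus>m\<in>?A. indexed_pmult F i (add_mset i m) \<otimes> strip_monom r a (add_mset i m))"
  proof (rule add.finprod_reindex)
    show "(\<lambda>m. indexed_pmult F i m \<otimes> strip_monom r a m) \<in> add_mset i ` ?A \<rightarrow> carrier R"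
      using F' a by (intro Pi_I m_closed strip_monom_closed)
    show "inj_on (add_mset i) ?A" by (rule inj_onI) simp
  qed
  finally show ?thesis by (simp add: indexed_pmult_def)
qed

lemma strip_poly_pmult_var:
  assumes F: "F \<in> mpolys R r e" and i: "i < r - 1" and a: "a \<in> affine_space R (r - 1)"
  shows "strip_poly R r (indexed_pmult F i) a j = a ! i \<otimes> strip_poly R r F a j"
proof -
  have ai: "a ! i \<in> carrier R" using a i by (rule affine_space_nth)
  have "i < r" using i by simp
  from strip_poly_pmult[OF F this a]
  have "strip_poly R r (indexed_pmult F i) a j =
      (\<Oplus>m\<in>slice r e j. F m \<otimes> strip_monom r a (add_mset i m))"
    using i by simp
  also have "\<dots> = (\<Oplus>m\<in>slice r e j. a ! i \<otimes> (F m \<otimes> strip_monom r a m))"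
    using mpolysD(1)[OF F] a ai i
    by (intro finsum_cong') (auto simp: strip_monom_add_mset m_lcomm)
  also have "\<dots> = a ! i \<otimes> strip_poly R r F a j"
    unfolding strip_poly_eq[OF F a]
    using mpolysD(1)[OF F] a ai by (intro finsum_rdistr[symmetric]) auto
  finally show ?thesis .
qed

lemma strip_poly_pmult_last:
  assumes F: "F \<in> mpolys R r e" and r: "r > 0" and a: "a \<in> affine_space R (r - 1)"
  shows "strip_poly R r (indexed_pmult F (r - 1)) a j =
    (case j of 0 \<Rightarrow> \<zero> | Suc i \<Rightarrow> strip_poly R r F a i)"
proof -
  have *: "strip_poly R r (indexed_pmult F (r - 1)) a j =
      (\<Oplus>m\<in>{m \<in> monomials r e. Suc (count m (r - 1)) = j}. F m \<otimes> strip_monom r a m)"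
    using strip_poly_pmult[OF F _ a, of "r - 1"] r by (simp add: strip_monom_add_mset_last[OF a, simplified])
  show ?thesis
  proof (cases j)
    case 0
    then show ?thesis using * by (simp only: nat.simps simp_thms Collect_empty_eq finsum_empty) simp
  next
    case (Suc i)
    then show ?thesis using * by (simp add: strip_poly_eq[OF F a])
  qed
qed

text \<open>\<open>column r e k Q\<close> stands for the polynomial \<open>Q(X\<^sub>1, \<dots>, X\<^sub>r\<^sub>-\<^sub>1) X\<^sub>r\<^sup>k\<close> of degree at most \<open>e\<close>.\<close>

definition column :: "nat \<Rightarrow> nat \<Rightarrow> nat \<Rightarrow> ('a list \<Rightarrow> 'a) \<Rightarrow> bool" where
  "column r e k Q \<longleftrightarrow> (\<exists>G\<in>mpolys R r e. \<forall>a\<in>affine_space R (r - 1). \<forall>j.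
     strip_poly R r G a j = (if j = k then Q a else \<zero>))"

lemma column_closed: "column r e k Q \<Longrightarrow> a \<in> affine_space R (r - 1) \<Longrightarrow> Q a \<in> carrier R"
  unfolding column_def using strip_poly_closed by metis

lemma column_cong:
  assumes "column r e k Q" "\<And>a. a \<in> affine_space R (r - 1) \<Longrightarrow> Q' a = Q a"
  shows "column r e k Q'"
proof -
  obtain G where "G \<in> mpolys R r e"
    "\<And>a j. a \<in> affine_space R (r - 1) \<Longrightarrow> strip_poly R r G a j = (if j = k then Q a else \<zero>)"
    using assms(1) by (auto simp: column_def)
  then show ?thesis unfolding column_def using assms(2) by (intro bexI[of _ G] ballI allI) simp_all
qed

lemma column_mono: "column r e k Q \<Longrightarrow> e \<le> e' \<Longrightarrow> column r e' k Q"
  unfolding column_def using mpolys_mono by blast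

lemma column_power:
  assumes "r > 0"
  shows "column r k k (\<lambda>a. \<one>)"
proof (induction k)
  case 0
  show ?case
    unfolding column_def using strip_poly_const[OF one_closed _ assms]
    by (intro bexI[OF _ const_mem_mpolys[OF one_closed]]) auto
next
  case (Suc k)
  then obtain G where G: "G \<in> mpolys R r k"
    "\<And>a j. a \<in> affine_space R (r - 1) \<Longrightarrow> strip_poly R r G a j = (if j = k then \<one> else \<zero>)"
    by (auto simp: column_def)
  have "indexed_pmult G (r - 1) \<in> mpolys R r (Suc k)"
    using assms G(1) by (intro pmult_mem_mpolys) auto
  moreover have "strip_poly R r (indexed_pmult G (r - 1)) a j = (if j = Suc k then \<one> else \<zero>)"
    if a: "a \<in> affine_space R (r - 1)" for a j
    unfolding strip_poly_pmult_last[OF G(1) assms a] using G(2)[OF a] by (auto split: nat.split)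
  ultimately show ?case unfolding column_def by blast
qed

lemma column_var:
  assumes "column r e k Q" "i < r - 1"
  shows "column r (Suc e) k (\<lambda>a. a ! i \<otimes> Q a)"
proof -
  obtain G where G: "G \<in> mpolys R r e"
    "\<And>a j. a \<in> affine_space R (r - 1) \<Longrightarrow> strip_poly R r G a j = (if j = k then Q a else \<zero>)"
    using assms(1) by (auto simp: column_def)
  have "indexed_pmult G i \<in> mpolys R r (Suc e)"
    using assms(2) G(1) by (intro pmult_mem_mpolys) auto
  moreover have "strip_poly R r (indexed_pmult G i) a j = (if j = k then a ! i \<otimes> Q a else \<zero>)"
    if a: "a \<in> affine_space R (r - 1)" for a j
    unfolding strip_poly_pmult_var[OF G(1) assms(2) a] G(2)[OF a]
    using affine_space_nth[OF a assms(2)] by simp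
  ultimately show ?thesis unfolding column_def by blast
qed

lemma column_scale:
  assumes "column r e k Q" "c \<in> carrier R"
  shows "column r e k (\<lambda>a. c \<otimes> Q a)"
proof -
  obtain G where G: "G \<in> mpolys R r e"
    "\<And>a j. a \<in> affine_space R (r - 1) \<Longrightarrow> strip_poly R r G a j = (if j = k then Q a else \<zero>)"
    using assms(1) by (auto simp: column_def)
  have "(\<lambda>m. c \<otimes> G m) \<in> mpolys R r e"
    using assms(2) G(1) by (intro scale_mem_mpolys)
  moreover have "strip_poly R r (\<lambda>m. c \<otimes> G m) a j = (if j = k then c \<otimes> Q a else \<zero>)"
    if a: "a \<in> affine_space R (r - 1)" for a j
    unfolding strip_poly_scale[OF G(1) assms(2) a] G(2)[OF a] using assms(2) by simp
  ultimately show ?thesis unfolding column_def by blast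
qed

lemma column_add:
  assumes "column r e k Q" "column r e k Q'"
  shows "column r e k (\<lambda>a. Q a \<oplus> Q' a)"
proof -
  obtain G where G: "G \<in> mpolys R r e"
    "\<And>a j. a \<in> affine_space R (r - 1) \<Longrightarrow> strip_poly R r G a j = (if j = k then Q a else \<zero>)"
    using assms(1) by (auto simp: column_def)
  obtain G' where G': "G' \<in> mpolys R r e"
    "\<And>a j. a \<in> affine_space R (r - 1) \<Longrightarrow> strip_poly R r G' a j = (if j = k then Q' a else \<zero>)"
    using assms(2) by (auto simp: column_def)
  have "strip_poly R r (indexed_padd G G') a j = (if j = k then Q a \<oplus> Q' a else \<zero>)"
    if a: "a \<in> affine_space R (r - 1)" for a j
    unfolding strip_poly_padd[OF G(1) G'(1) a] G(2)[OF a] G'(2)[OF a] by simp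
  then show ?thesis unfolding column_def using padd_mem_mpolys[OF G(1) G'(1)] by blast
qed

text \<open>Common source of the two kinds of separating functions below: coordinate differences,
  with \<open>v = \<zero>\<close>, and the equations of a line. Such a factor raises the degree by
  one.\<close>

lemma column_linear:
  assumes Q: "column r e k Q" and ij: "i < r - 1" "j < r - 1"
    and uv: "u \<in> carrier R" "v \<in> carrier R" "s \<in> carrier R" "t \<in> carrier R"
  shows "column r (Suc e) k (\<lambda>a. (u \<otimes> (a ! i \<ominus> s) \<ominus> v \<otimes> (a ! j \<ominus> t)) \<otimes> Q a)"
proof (rule column_cong)
  have Q': "column r (Suc e) k Q" using Q by (rule column_mono) simp
  show "column r (Suc e) k (\<lambda>a. u \<otimes> (a ! i \<otimes> Q a \<oplus> (\<ominus> s) \<otimes> Q a)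
      \<oplus> (\<ominus> v) \<otimes> (a ! j \<otimes> Q a \<oplus> (\<ominus> t) \<otimes> Q a))"
    using uv by (intro column_add column_scale column_var Q Q' ij a_inv_closed)
  fix a assume a: "a \<in> affine_space R (r - 1)"
  have cl: "Q a \<in> carrier R" "a ! i \<in> carrier R" "a ! j \<in> carrier R"
    using column_closed[OF Q a] affine_space_nth[OF a] ij by auto
  show "(u \<otimes> (a ! i \<ominus> s) \<ominus> v \<otimes> (a ! j \<ominus> t)) \<otimes> Q a =
      u \<otimes> (a ! i \<otimes> Q a \<oplus> (\<ominus> s) \<otimes> Q a) \<oplus> (\<ominus> v) \<otimes> (a ! j \<otimes> Q a \<oplus> (\<ominus> t) \<otimes> Q a)"
    using cl uv by algebra
qed

section \<open>Separation of points by linear functions\<close>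

lemma affine_space_eq_iff:
  assumes "x \<in> affine_space R n" "y \<in> affine_space R n"
  shows "x = y \<longleftrightarrow> (\<forall>i<n. x ! i = y ! i)"
  using assms by (auto simp: affine_space_def list_eq_iff_nth_eq)

lemma column_separate:
  assumes x: "x \<in> affine_space R (r - 1)" and y: "y \<in> affine_space R (r - 1)" and "x \<noteq> y"
  obtains l where
    "\<And>e k Q. column r e k Q \<Longrightarrow> column r (Suc e) k (\<lambda>a. l a \<otimes> Q a)"
    "\<And>a. a \<in> affine_space R (r - 1) \<Longrightarrow> l a \<in> carrier R" "l x \<noteq> \<zero>" "l y = \<zero>"
proof -
  obtain i where i: "i < r - 1" "x ! i \<noteq> y ! i"
    using assms affine_space_eq_iff by blast
  \<comment> \<open>A coordinate in which \<open>x\<close> and \<open>y\<close> differ, centered at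
    \<open>y\<close>; the second term with coefficient \<open>\<zero>\<close> fits it into
    \<open>column_linear\<close>.\<close>
  define l where "l = (\<lambda>a. \<one> \<otimes> (a ! i \<ominus> y ! i) \<ominus> \<zero> \<otimes> (a ! i \<ominus> y ! i))"
  have yi: "y ! i \<in> carrier R" using affine_space_nth[OF y i(1)] .
  have l: "l a = a ! i \<ominus> y ! i" if "a \<in> affine_space R (r - 1)" for a
    using affine_space_nth[OF that i(1)] yi by (simp add: l_def a_minus_def)
  show thesis
  proof
    show "column r (Suc e) k (\<lambda>a. l a \<otimes> Q a)" if "column r e k Q" for e k Q
      unfolding l_def using i yi by (intro column_linear that) auto
    show "l a \<in> carrier R" if "a \<in> affine_space R (r - 1)" for a
      using l[OF that] affine_space_nth[OF that i(1)] yi by simp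
    show "l x \<noteq> \<zero>" "l y = \<zero>"
      using l x y i(2) yi affine_space_nth[OF x i(1)] by simp_all
  qed
qed

text \<open>For \<open>x \<noteq> y\<close> this is the affine line through both points, cut out by
  the 2x2 minors of y - x and w - x. Equations instead of a parametrization directly provide a
  linear function that is nonzero at a given point off the line.\<close>

definition line :: "nat \<Rightarrow> 'a list \<Rightarrow> 'a list \<Rightarrow> 'a list set" where
  "line n x y = {w \<in> affine_space R n. \<forall>i<n. \<forall>j<n.
     (y ! i \<ominus> x ! i) \<otimes> (w ! j \<ominus> x ! j) = (y ! j \<ominus> x ! j) \<otimes> (w ! i \<ominus> x ! i)}"

lemma line_props:
  assumes x: "x \<in> affine_space R n" and y: "y \<in> affine_space R n" and "x \<noteq> y"
  shows "line n x y \<subseteq> affine_space R n" "x \<in> line n x y" "y \<in> line n x y"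
    "card (line n x y) \<le> order R"
proof -
  show "line n x y \<subseteq> affine_space R n" by (auto simp: line_def)
  have cl: "x ! i \<in> carrier R" "y ! i \<in> carrier R" if "i < n" for i
    using that affine_space_nth x y by blast+
  show "x \<in> line n x y" "y \<in> line n x y"
    using x y cl by (auto simp: line_def m_comm r_neg a_minus_def)
  obtain i where i: "i < n" "x ! i \<noteq> y ! i"
    using assms affine_space_eq_iff by blast
  have ne: "y ! i \<ominus> x ! i \<noteq> \<zero>" using cl[OF i(1)] i(2) by simp
  \<comment> \<open>On the line, a coordinate that separates \<open>x\<close> and \<open>y\<close>
    determines all the others, so the line injects into the field.\<close>
  have "inj_on (\<lambda>w. w ! i) (line n x y)"
  proof (rule inj_onI)
    fix w w' assume w: "w \<in> line n x y" "w' \<in> line n x y" and eq: "w ! i = w' ! i"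
    then have W: "w \<in> affine_space R n" "w' \<in> affine_space R n" by (auto simp: line_def)
    have "w ! j = w' ! j" if j: "j < n" for j
    proof -
      have cl': "w ! j \<in> carrier R" "w' ! j \<in> carrier R"
        using W j affine_space_nth by blast+
      have "(y ! i \<ominus> x ! i) \<otimes> (v ! j \<ominus> x ! j) = (y ! j \<ominus> x ! j) \<otimes> (v ! i \<ominus> x ! i)"
        if "v \<in> line n x y" for v
        using that i(1) j unfolding line_def by blast
      from this[OF w(1)] this[OF w(2)]
      have "(y ! i \<ominus> x ! i) \<otimes> (w ! j \<ominus> x ! j) = (y ! i \<ominus> x ! i) \<otimes> (w' ! j \<ominus> x ! j)"
        using eq by simp
      then have "w ! j \<ominus> x ! j = w' ! j \<ominus> x ! j"
        using m_lcancel[OF ne] cl[OF i(1)] cl[OF j] cl' by simp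
      then show ?thesis using cl[OF j] cl' by (simp add: a_minus_def)
    qed
    then show "w = w'" using affine_space_eq_iff[OF W] by blast
  qed
  moreover have "(\<lambda>w. w ! i) ` line n x y \<subseteq> carrier R"
    using affine_space_nth[OF _ i(1)] by (auto simp: line_def)
  ultimately show "card (line n x y) \<le> order R"
    unfolding order_def using finite_carrier by (rule card_inj_on_le)
qed

text \<open>A point off the line violates one of the defining equations. The difference of its two
  sides, as a function of the point, is linear and vanishes at \<open>x\<close> and
  \<open>y\<close>.\<close>

lemma column_separate_line:
  assumes x: "x \<in> affine_space R (r - 1)" and y: "y \<in> affine_space R (r - 1)"
    and w: "w \<in> affine_space R (r - 1)" "w \<notin> line (r - 1) x y"
  obtains l where
    "\<And>e k Q. column r e k Q \<Longrightarrow> column r (Suc e) k (\<lambda>a. l a \<otimes> Q a)"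
    "\<And>a. a \<in> affine_space R (r - 1) \<Longrightarrow> l a \<in> carrier R" "l w \<noteq> \<zero>" "l x = \<zero>" "l y = \<zero>"
proof -
  obtain i j where ij: "i < r - 1" "j < r - 1"
    "(y ! i \<ominus> x ! i) \<otimes> (w ! j \<ominus> x ! j) \<noteq> (y ! j \<ominus> x ! j) \<otimes> (w ! i \<ominus> x ! i)"
    using w by (auto simp: line_def)
  define l where "l = (\<lambda>a. (y ! i \<ominus> x ! i) \<otimes> (a ! j \<ominus> x ! j) \<ominus> (y ! j \<ominus> x ! j) \<otimes> (a ! i \<ominus> x ! i))"
  have cl: "x ! i \<in> carrier R" "x ! j \<in> carrier R" "y ! i \<in> carrier R" "y ! j \<in> carrier R"
    using x y ij affine_space_nth by blast+
  have cla: "a ! i \<in> carrier R" "a ! j \<in> carrier R" if "a \<in> affine_space R (r - 1)" for a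
    using that ij affine_space_nth by blast+
  show thesis
  proof
    show "column r (Suc e) k (\<lambda>a. l a \<otimes> Q a)" if "column r e k Q" for e k Q
      unfolding l_def using ij cl by (intro column_linear that minus_closed)
    show "l a \<in> carrier R" if "a \<in> affine_space R (r - 1)" for a
      using cl cla[OF that] by (simp add: l_def)
    show "l w \<noteq> \<zero>"
      using ij(3) cl cla[OF w(1)] by (simp add: l_def)
    show "l x = \<zero>" "l y = \<zero>"
      using cl by (simp_all add: l_def m_comm r_neg a_minus_def)
  qed
qed

subsection \<open>Moments of the number of strips with a zero\<close>

lemma bij_betw_add_carrier: "u \<in> carrier R \<Longrightarrow> bij_betw (\<lambda>s. s \<oplus> u) (carrier R) (carrier R)"
  unfolding bij_betw_def
  by (intro conjI endo_inj_surj finite_carrier inj_onI) auto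

lemma bij_betw_mult_carrier:
  assumes u: "u \<in> carrier R" "u \<noteq> \<zero>"
  shows "bij_betw (\<lambda>s. s \<otimes> u) (carrier R) (carrier R)"
proof -
  have "inj_on (\<lambda>s. s \<otimes> u) (carrier R)"
    using m_rcancel[OF u(2,1)] by (auto intro: inj_onI)
  moreover have "(\<lambda>s. s \<otimes> u) ` carrier R \<subseteq> carrier R" using u by auto
  ultimately show ?thesis
    unfolding bij_betw_def using endo_inj_surj[OF finite_carrier] by blast
qed

lemma affine_space_nonempty: "affine_space R n \<noteq> {}"
proof -
  have "replicate n \<zero> \<in> affine_space R n" by (auto simp: affine_space_def)
  then show ?thesis by blast
qed

lemma finite_affine_space [simp]: "finite (affine_space R n)"
  unfolding affine_space_def using finite_lists_length_eq[OF finite_carrier] by simp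

lemma card_affine_space: "card (affine_space R n) = order R ^ n"
  unfolding affine_space_def order_def using card_lists_length_eq[OF finite_carrier] by simp

text \<open>In such a class all strip polynomials have the same coefficient \<open>c\<close> at
  \<open>d\<close>. Translation by elements of \<open>with_lead r d \<zero>\<close> preserves the
  class.\<close>

definition with_lead :: "nat \<Rightarrow> nat \<Rightarrow> 'a \<Rightarrow> 'a mpoly set" where
  "with_lead r d c = {F \<in> mpolys R r d. F (replicate_mset d (r - 1)) = c}"

lemma finite_with_lead [simp]: "finite (with_lead r d c)"
  by (simp add: with_lead_def)

lemma strip_poly_with_lead:
  assumes "F \<in> with_lead r d c" "a \<in> affine_space R (r - 1)" "r > 0"
  shows "strip_poly R r F a d = c"
  using assms strip_poly_top[of F r d a] by (auto simp: with_lead_def)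

lemma padd_mem_with_lead:
  assumes F: "F \<in> with_lead r d c" and G: "G \<in> with_lead r d \<zero>" and c: "c \<in> carrier R"
  shows "indexed_padd F G \<in> with_lead r d c"
  using assms padd_mem_mpolys[of F r d G] by (auto simp: with_lead_def indexed_padd_def)

lemma inj_on_padd:
  assumes "G \<in> mpolys R r d"
  shows "inj_on (\<lambda>F. indexed_padd F G) (mpolys R r d)"
proof (rule inj_onI)
  fix F F' assume F: "F \<in> mpolys R r d" "F' \<in> mpolys R r d" "indexed_padd F G = indexed_padd F' G"
  have "F m = F' m" for m
    using fun_cong[OF F(3), of m] mpolysD(1)[OF F(1), of m] mpolysD(1)[OF F(2), of m]
      mpolysD(1)[OF assms, of m] by (simp add: indexed_padd_def)
  then show "F = F'" by blast
qed

section \<open>Indicators centered over the constant term and their fourth moment\<close>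

definition has_zero :: "nat \<Rightarrow> nat \<Rightarrow> 'a list \<Rightarrow> 'a mpoly \<Rightarrow> bool" where
  "has_zero r d a F \<longleftrightarrow> (\<exists>t\<in>carrier R. poly_eval d (strip_poly R r F a) t = \<zero>)"

text \<open>
  \<open>card (shifts r d a F) / order R\<close> is the probability of a zero in the strip over \<open>a\<close> when only
  the constant term of \<open>F\<close> is random. It depends on \<open>F\<close>, but is invariant under translation by
  polynomials in the first \<open>r - 1\<close> variables.
\<close>

definition shifts :: "nat \<Rightarrow> nat \<Rightarrow> 'a list \<Rightarrow> 'a mpoly \<Rightarrow> 'a set" where
  "shifts r d a F = {s \<in> carrier R. \<exists>t\<in>carrier R. poly_eval d (strip_poly R r F a) t \<oplus> s = \<zero>}"

text \<open>Orthogonality now requires only the constant term to be randomized, so quadratic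
  multipliers fit into total degree \<open>d\<close> already for \<open>d = 2\<close>. Centering at
  the overall probability requires moving all coefficients below \<open>d\<close>, and the one at
  \<open>d - 1\<close> admits only multipliers of degree 1.\<close>

definition shift_centered :: "nat \<Rightarrow> nat \<Rightarrow> 'a list \<Rightarrow> 'a mpoly \<Rightarrow> real" where
  "shift_centered r d a F = of_bool (has_zero r d a F) - real (card (shifts r d a F)) / real (order R)"

lemma shifts_subset: "shifts r d a F \<subseteq> carrier R"
  by (auto simp: shifts_def)

lemma card_shifts_le: "card (shifts r d a F) \<le> order R"
  unfolding order_def using finite_carrier shifts_subset by (rule card_mono)

lemma abs_shift_centered_le: "\<bar>shift_centered r d a F\<bar> \<le> 1"
proof -
  have "real (card (shifts r d a F)) / real (order R) \<le> 1"
    using card_shifts_le[of r d a F] order_ge_2 by simp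
  moreover have "0 \<le> real (card (shifts r d a F)) / real (order R)" by simp
  ultimately show ?thesis by (auto simp: shift_centered_def of_bool_def)
qed

lemma poly_eval_translate:
  assumes F: "F \<in> mpolys R r d" and G: "G \<in> mpolys R r d" and a: "a \<in> affine_space R (r - 1)"
    and GQ: "\<And>j. strip_poly R r G a j = (if j = 0 then u else \<zero>)"
    and t: "t \<in> carrier R"
  shows "poly_eval d (strip_poly R r (indexed_padd F G) a) t = poly_eval d (strip_poly R r F a) t \<oplus> u"
proof -
  have u: "u \<in> carrier R" using strip_poly_closed[OF G a, of 0] GQ by simp
  have "poly_eval d (strip_poly R r (indexed_padd F G) a) t =
      poly_eval d (\<lambda>j. strip_poly R r F a j \<oplus> (if j = 0 then u else \<zero>)) t"
    using strip_poly_closed[OF F a] u t strip_poly_padd[OF F G a] GQ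
    by (intro poly_eval_cong) auto
  also have "\<dots> = poly_eval d (strip_poly R r F a) t \<oplus> poly_eval d (\<lambda>j. if j = 0 then u else \<zero>) t"
    using strip_poly_closed[OF F a] u t by (intro poly_eval_add) auto
  also have "poly_eval d (\<lambda>j. if j = 0 then u else \<zero>) t = u"
    using poly_eval_monomial[of 0 d u t] u t by simp
  finally show ?thesis .
qed

text \<open>Adding \<open>u\<close> to the constant coefficient moves the set of shifts by a
  translation of the field.\<close>

lemma card_shifts_translate:
  assumes F: "F \<in> mpolys R r d" and G: "G \<in> mpolys R r d" and a: "a \<in> affine_space R (r - 1)"
    and GQ: "\<And>j. strip_poly R r G a j = (if j = 0 then u else \<zero>)"
  shows "card (shifts r d a (indexed_padd F G)) = card (shifts r d a F)"
proof -
  have u: "u \<in> carrier R" using strip_poly_closed[OF G a, of 0] GQ by simp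
  note bij = bij_betw_add_carrier[OF u]
  have "(\<lambda>s. s \<oplus> u) ` shifts r d a (indexed_padd F G) = shifts r d a F"
  proof (intro equalityI subsetI)
    fix s assume "s \<in> (\<lambda>s. s \<oplus> u) ` shifts r d a (indexed_padd F G)"
    then obtain s' t where s': "s = s' \<oplus> u" "s' \<in> carrier R" and t: "t \<in> carrier R"
      and z: "poly_eval d (strip_poly R r (indexed_padd F G) a) t \<oplus> s' = \<zero>"
      by (auto simp: shifts_def)
    have "poly_eval d (strip_poly R r F a) t \<in> carrier R"
      using strip_poly_closed[OF F a] t by simp
    then have "poly_eval d (strip_poly R r F a) t \<oplus> s = \<zero>"
      using z s' u unfolding poly_eval_translate[OF F G a GQ t] by (simp add: a_ac)
    then show "s \<in> shifts r d a F" using s' u t by (auto simp: shifts_def)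
  next
    fix s assume s: "s \<in> shifts r d a F"
    then have "s \<in> (\<lambda>s. s \<oplus> u) ` carrier R"
      using bij shifts_subset unfolding bij_betw_def by blast
    then obtain s' where s': "s = s' \<oplus> u" "s' \<in> carrier R" by blast
    obtain t where t: "t \<in> carrier R" "poly_eval d (strip_poly R r F a) t \<oplus> s = \<zero>"
      using s by (auto simp: shifts_def)
    have "poly_eval d (strip_poly R r F a) t \<in> carrier R"
      using strip_poly_closed[OF F a] t by simp
    then have "poly_eval d (strip_poly R r (indexed_padd F G) a) t \<oplus> s' = \<zero>"
      using t s' u unfolding poly_eval_translate[OF F G a GQ t(1)] by (simp add: a_ac)
    then have "s' \<in> shifts r d a (indexed_padd F G)" using s' t by (auto simp: shifts_def)
    then show "s \<in> (\<lambda>s. s \<oplus> u) ` shifts r d a (indexed_padd F G)" using s' by blast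
  qed
  moreover have "inj_on (\<lambda>s. s \<oplus> u) (shifts r d a (indexed_padd F G))"
    using bij shifts_subset unfolding bij_betw_def by (blast intro: inj_on_subset)
  ultimately show ?thesis using card_image by metis
qed

text \<open>Translation by the multiples of \<open>Q\<close>: at \<open>w\<close> the added constant
  runs once through the whole field, so the indicator averages to
  \<open>card (shifts r d w F) / order R\<close>, while nothing changes at the points of
  \<open>S\<close>. The condition on \<open>\<psi>\<close> says that it depends on \<open>F\<close>
  only through the centered indicators at \<open>S\<close>.\<close>

lemma sum_shift_centered_mult:
  assumes rd: "r > 0" "d > 0" and c: "c \<in> carrier R" and Q: "column r d 0 Q"
    and w: "w \<in> affine_space R (r - 1)" "Q w \<noteq> \<zero>"
    and S: "\<And>a. a \<in> S \<Longrightarrow> a \<in> affine_space R (r - 1) \<and> Q a = \<zero>"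
    and \<psi>: "\<And>F F'. (\<And>a. a \<in> S \<Longrightarrow> shift_centered r d a F' = shift_centered r d a F) \<Longrightarrow> \<psi> F' = \<psi> F"
  shows "(\<Sum>F\<in>with_lead r d c. shift_centered r d w F * \<psi> F) = 0"
proof -
  obtain G where G: "G \<in> mpolys R r d"
    "\<And>a j. a \<in> affine_space R (r - 1) \<Longrightarrow> strip_poly R r G a j = (if j = 0 then Q a else \<zero>)"
    using Q by (auto simp: column_def)
  define sG where "sG = (\<lambda>s m. s \<otimes> G m)"
  have sG: "sG s \<in> mpolys R r d" if "s \<in> carrier R" for s
    unfolding sG_def using G(1) that by (rule scale_mem_mpolys)
  have strip_sG: "strip_poly R r (sG s) a j = (if j = 0 then s \<otimes> Q a else \<zero>)"
    if "s \<in> carrier R" "a \<in> affine_space R (r - 1)" for s a j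
    unfolding sG_def strip_poly_scale[OF G(1) that] G(2)[OF that(2)] using that(1) by simp
  \<comment> \<open>Here \<open>d > 0\<close> matters: \<open>sG s\<close> only affects strip
    coefficients at 0, so its coefficient at the \<open>d\<close>-th power of the last variable is
    zero.\<close>
  have sG0: "sG s \<in> with_lead r d \<zero>" if "s \<in> carrier R" for s
    using strip_poly_top[OF sG[OF that] w(1) rd(1)] strip_sG[OF that w(1)] sG[OF that] rd
    by (simp add: with_lead_def)
  have mem: "F \<in> mpolys R r d" if "F \<in> with_lead r d c" for F
    using that by (simp add: with_lead_def)
  have shiftcard: "card (shifts r d a (indexed_padd F (sG s))) = card (shifts r d a F)"
    if "F \<in> with_lead r d c" "s \<in> carrier R" "a \<in> affine_space R (r - 1)" for F s a
    by (rule card_shifts_translate[OF mem[OF that(1)] sG[OF that(2)] that(3) strip_sG[OF that(2,3)]])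
  have eval: "poly_eval d (strip_poly R r (indexed_padd F (sG s)) a) t = poly_eval d (strip_poly R r F a) t \<oplus> s \<otimes> Q a"
    if "F \<in> with_lead r d c" "s \<in> carrier R" "a \<in> affine_space R (r - 1)" "t \<in> carrier R" for F s a t
    by (rule poly_eval_translate[OF mem[OF that(1)] sG[OF that(2)] that(3) strip_sG[OF that(2,3)] that(4)])
  have "(\<Sum>F\<in>with_lead r d c. shift_centered r d w F * \<psi> F) = 0 * (\<Sum>F\<in>with_lead r d c. \<psi> F)"
  proof (rule sum_translation_average[where H = "carrier R" and T = "\<lambda>s F. indexed_padd F (sG s)"])
    fix s assume s: "s \<in> carrier R"
    show "(\<lambda>F. indexed_padd F (sG s)) ` with_lead r d c \<subseteq> with_lead r d c"
      using padd_mem_with_lead[OF _ sG0[OF s] c] by blast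
    show "inj_on (\<lambda>F. indexed_padd F (sG s)) (with_lead r d c)"
      by (rule inj_on_subset[OF inj_on_padd[OF sG[OF s]]]) (auto simp: with_lead_def)
    fix F assume F: "F \<in> with_lead r d c"
    show "\<psi> (indexed_padd F (sG s)) = \<psi> F"
    proof (rule \<psi>)
      fix a assume "a \<in> S"
      then have a: "a \<in> affine_space R (r - 1)" "Q a = \<zero>" using S by auto
      have cl: "poly_eval d (strip_poly R r F a) t \<in> carrier R" if "t \<in> carrier R" for t
        using strip_poly_closed[OF mem[OF F] a(1)] that by simp
      have "has_zero r d a (indexed_padd F (sG s)) \<longleftrightarrow> has_zero r d a F"
        unfolding has_zero_def using eval[OF F s a(1)] a(2) s cl by simp
      then show "shift_centered r d a (indexed_padd F (sG s)) = shift_centered r d a F"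
        by (simp add: shift_centered_def shiftcard[OF F s a(1)])
    qed
  next
    fix F assume F: "F \<in> with_lead r d c"
    have Qw: "Q w \<in> carrier R" using column_closed[OF Q w(1)] .
    have "(\<Sum>s\<in>carrier R. of_bool (has_zero r d w (indexed_padd F (sG s)))) =
        (\<Sum>s\<in>carrier R. of_bool (s \<otimes> Q w \<in> shifts r d w F) :: real)"
      by (intro sum.cong refl)
        (use eval[OF F _ w(1)] Qw in \<open>simp add: has_zero_def shifts_def\<close>)
    \<comment> \<open>Multiplication by \<open>Q w \<noteq> \<zero>\<close> permutes the
      field.\<close>
    also have "\<dots> = (\<Sum>s\<in>carrier R. of_bool (s \<in> shifts r d w F))"
      by (rule sum.reindex_bij_betw[OF bij_betw_mult_carrier[OF Qw w(2)],
            where g = "\<lambda>s. of_bool (s \<in> shifts r d w F)"])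
    also have "\<dots> = real (card {s \<in> carrier R. s \<in> shifts r d w F})"
      by (rule card_filter_eq_sum[OF finite_carrier, symmetric])
    also have "{s \<in> carrier R. s \<in> shifts r d w F} = shifts r d w F"
      using shifts_subset by blast
    finally show "(\<Sum>s\<in>carrier R. shift_centered r d w (indexed_padd F (sG s))) = real (card (carrier R)) * 0"
      using order_ge_2
      by (simp add: shift_centered_def sum_subtractf shiftcard[OF F _ w(1)] order_def)
  qed (use finite_carrier in auto)
  then show ?thesis by simp
qed

lemma column_separate2:
  assumes r: "r > 0" and x: "x \<in> affine_space R (r - 1)"
    and y: "y \<in> affine_space R (r - 1)" "x \<noteq> y" and z: "z \<in> affine_space R (r - 1)" "x \<noteq> z"
  obtains Q where "column r 2 0 Q" "Q x \<noteq> \<zero>" "Q y = \<zero>" "Q z = \<zero>"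
proof -
  obtain l where l: "\<And>e k Q. column r e k Q \<Longrightarrow> column r (Suc e) k (\<lambda>a. l a \<otimes> Q a)"
    "\<And>a. a \<in> affine_space R (r - 1) \<Longrightarrow> l a \<in> carrier R" "l x \<noteq> \<zero>" "l y = \<zero>"
    by (rule column_separate[OF x y], rule that)
  obtain l' where l': "\<And>e k Q. column r e k Q \<Longrightarrow> column r (Suc e) k (\<lambda>a. l' a \<otimes> Q a)"
    "\<And>a. a \<in> affine_space R (r - 1) \<Longrightarrow> l' a \<in> carrier R" "l' x \<noteq> \<zero>" "l' z = \<zero>"
    by (rule column_separate[OF x z], rule that)
  show thesis
  proof
    show "column r 2 0 (\<lambda>a. l a \<otimes> (l' a \<otimes> \<one>))"
      using l(1)[OF l'(1)[OF column_power[OF r, of 0]]] by (simp add: numeral_2_eq_2)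
    show "l x \<otimes> (l' x \<otimes> \<one>) \<noteq> \<zero>" using l(2)[OF x] l(3) l'(2)[OF x] l'(3) by (simp add: integral_iff)
    show "l y \<otimes> (l' y \<otimes> \<one>) = \<zero>" "l z \<otimes> (l' z \<otimes> \<one>) = \<zero>" using l(2)[OF z(1)] l(4) l'(2)[OF y(1)] l'(4) by simp_all
  qed
qed

text \<open>One linear function vanishes at both \<open>x\<close> and \<open>y\<close>, a second one
  at \<open>z\<close>. Three zeros thus cost only degree 2, which is available for every
  \<open>d \<ge> 2\<close>.\<close>

lemma column_separate3:
  assumes r: "r > 0" and x: "x \<in> affine_space R (r - 1)" and y: "y \<in> affine_space R (r - 1)"
    and w: "w \<in> affine_space R (r - 1)" "w \<notin> line (r - 1) x y"
    and z: "z \<in> affine_space R (r - 1)" "w \<noteq> z"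
  obtains Q where "column r 2 0 Q" "Q w \<noteq> \<zero>" "Q x = \<zero>" "Q y = \<zero>" "Q z = \<zero>"
proof -
  obtain l where l: "\<And>e k Q. column r e k Q \<Longrightarrow> column r (Suc e) k (\<lambda>a. l a \<otimes> Q a)"
    "\<And>a. a \<in> affine_space R (r - 1) \<Longrightarrow> l a \<in> carrier R" "l w \<noteq> \<zero>" "l x = \<zero>" "l y = \<zero>"
    by (rule column_separate_line[OF x y w], rule that)
  obtain l' where l': "\<And>e k Q. column r e k Q \<Longrightarrow> column r (Suc e) k (\<lambda>a. l' a \<otimes> Q a)"
    "\<And>a. a \<in> affine_space R (r - 1) \<Longrightarrow> l' a \<in> carrier R" "l' w \<noteq> \<zero>" "l' z = \<zero>"
    by (rule column_separate[OF w(1) z], rule that)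
  show thesis
  proof
    show "column r 2 0 (\<lambda>a. l a \<otimes> (l' a \<otimes> \<one>))"
      using l(1)[OF l'(1)[OF column_power[OF r, of 0]]] by (simp add: numeral_2_eq_2)
    show "l w \<otimes> (l' w \<otimes> \<one>) \<noteq> \<zero>" using l(2)[OF w(1)] l(3) l'(2)[OF w(1)] l'(3) by (simp add: integral_iff)
    show "l x \<otimes> (l' x \<otimes> \<one>) = \<zero>" "l y \<otimes> (l' y \<otimes> \<one>) = \<zero>" "l z \<otimes> (l' z \<otimes> \<one>) = \<zero>"
      using l(2)[OF z(1)] l(4,5) l'(2)[OF x] l'(2)[OF y] l'(4) by simp_all
  qed
qed

lemma shift_centered_fourth_moment:
  assumes r: "r > 0" and d: "d \<ge> 2" and c: "c \<in> carrier R"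
  shows "(\<Sum>F\<in>with_lead r d c. (\<Sum>a\<in>affine_space R (r - 1). shift_centered r d a F) ^ 4)
    \<le> real (card (with_lead r d c)) * real (order R ^ (r - 1)) ^ 2 * (real (order R) + 1)"
proof -
  have d0: "d > 0" using d by simp
  note col = column_mono[OF _ d]
  have "(\<Sum>F\<in>with_lead r d c. (\<Sum>a\<in>affine_space R (r - 1). shift_centered r d a F) ^ 4)
    \<le> real (card (with_lead r d c)) * real (card (affine_space R (r - 1))) ^ 2 * (real (order R) + 1)"
  proof (rule fourth_moment_le[where L = "line (r - 1)"])
    fix x y assume x: "x \<in> affine_space R (r - 1)" and y: "y \<in> affine_space R (r - 1)" and xy: "x \<noteq> y"
    show "line (r - 1) x y \<subseteq> affine_space R (r - 1) \<and> x \<in> line (r - 1) x y \<and>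
        y \<in> line (r - 1) x y \<and> card (line (r - 1) x y) \<le> order R"
      using line_props[OF x y xy] by blast
    \<comment> \<open>The case of a pair is that of a triple with \<open>z = y\<close>.\<close>
    obtain Q where Q: "column r 2 0 Q" "Q x \<noteq> \<zero>" "Q y = \<zero>" "Q y = \<zero>"
      by (rule column_separate2[OF r x y xy y xy], rule that)
    show "(\<Sum>F\<in>with_lead r d c. shift_centered r d x F * shift_centered r d y F) = 0"
      by (rule sum_shift_centered_mult[OF r d0 c col[OF Q(1)] x Q(2), where S = "{y}"]) (use Q y in auto)
    fix z assume z: "z \<in> affine_space R (r - 1)"
    {
      assume "x \<noteq> z" "y \<noteq> z"
      \<comment> \<open>The square at \<open>z\<close> need not be centered: it suffices to separate
        \<open>x\<close> from \<open>y\<close> and \<open>z\<close>.\<close>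
      obtain Q where Q: "column r 2 0 Q" "Q x \<noteq> \<zero>" "Q y = \<zero>" "Q z = \<zero>"
        by (rule column_separate2[OF r x y xy z \<open>x \<noteq> z\<close>], rule that)
      show "(\<Sum>F\<in>with_lead r d c. shift_centered r d x F *
          (shift_centered r d y F * (shift_centered r d z F * shift_centered r d z F))) = 0"
        by (rule sum_shift_centered_mult[OF r d0 c col[OF Q(1)] x Q(2), where S = "{y, z}"]) (use Q y z in auto)
    }
    fix w assume w: "w \<in> affine_space R (r - 1)" "w \<notin> line (r - 1) x y" and "z \<noteq> w"
    then have "w \<noteq> z" by simp
    \<comment> \<open>Here \<open>z\<close> may coincide with \<open>x\<close> or \<open>y\<close>;
      only \<open>w\<close> has to be separated from the other points.\<close>
    obtain Q where Q: "column r 2 0 Q" "Q w \<noteq> \<zero>" "Q x = \<zero>" "Q y = \<zero>" "Q z = \<zero>"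
      by (rule column_separate3[OF r x y w z \<open>w \<noteq> z\<close>], rule that)
    show "(\<Sum>F\<in>with_lead r d c. shift_centered r d w F *
        (shift_centered r d x F * (shift_centered r d y F * shift_centered r d z F))) = 0"
      by (rule sum_shift_centered_mult[OF r d0 c col[OF Q(1)] w(1) Q(2), where S = "{x, y, z}"]) (use Q x y z in auto)
  qed (use abs_shift_centered_le in auto)
  then show ?thesis by (simp add: card_affine_space)
qed

text \<open>Every \<open>t\<close> is a zero for exactly one shift, namely minus the value at
  \<open>t\<close>. A shifted polynomial keeps the leading coefficient
  \<open>c \<noteq> \<zero>\<close>, as \<open>d > 0\<close>, and so has at most \<open>d\<close>
  zeros.\<close>

lemma order_le_card_shifts:
  assumes F: "F \<in> with_lead r d c" and c: "c \<noteq> \<zero>" and rd: "r > 0" "d > 0"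
    and a: "a \<in> affine_space R (r - 1)"
  shows "order R \<le> d * card (shifts r d a F)"
proof -
  let ?f = "strip_poly R r F a"
  have Fm: "F \<in> mpolys R r d" using F by (simp add: with_lead_def)
  note cl = strip_poly_closed[OF Fm a]
  define fib where "fib = (\<lambda>s. {t \<in> carrier R. poly_eval d ?f t \<oplus> s = \<zero>})"
  have fib_le: "card (fib s) \<le> d" if s: "s \<in> shifts r d a F" for s
  proof -
    have sR: "s \<in> carrier R" using s shifts_subset by blast
    let ?g = "\<lambda>j. ?f j \<oplus> (if j = 0 then s else \<zero>)"
    have "fib s = {t \<in> carrier R. poly_eval d ?g t = \<zero>}"
      unfolding fib_def
    proof (intro Collect_cong conj_cong refl)
      fix t assume t: "t \<in> carrier R"
      have "poly_eval d ?g t = poly_eval d ?f t \<oplus> poly_eval d (\<lambda>j. if j = 0 then s else \<zero>) t"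
        using cl sR t by (intro poly_eval_add) auto
      also have "poly_eval d (\<lambda>j. if j = 0 then s else \<zero>) t = s"
        using poly_eval_monomial[of 0 d s t] sR t by simp
      finally show "(poly_eval d ?f t \<oplus> s = \<zero>) = (poly_eval d ?g t = \<zero>)" by simp
    qed
    also have "card \<dots> \<le> d"
      using cl sR rd c strip_poly_with_lead[OF F a rd(1)] by (intro card_roots_le[where k = d]) auto
    finally show ?thesis .
  qed
  have fin: "finite (shifts r d a F)" by (rule finite_subset[OF shifts_subset finite_carrier])
  have "carrier R \<subseteq> (\<Union>s\<in>shifts r d a F. fib s)"
  proof
    fix t assume t: "t \<in> carrier R"
    have ev: "poly_eval d ?f t \<in> carrier R" using cl t by simp
    then have "poly_eval d ?f t \<oplus> (\<ominus> poly_eval d ?f t) = \<zero>" by (rule r_neg)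
    then show "t \<in> (\<Union>s\<in>shifts r d a F. fib s)"
      using t ev by (intro UN_I[of "\<ominus> poly_eval d ?f t"]) (auto simp: shifts_def fib_def)
  qed
  then have "order R \<le> card (\<Union>s\<in>shifts r d a F. fib s)"
    unfolding order_def using fin finite_carrier by (intro card_mono) (auto simp: fib_def)
  also have "\<dots> \<le> (\<Sum>s\<in>shifts r d a F. card (fib s))" using fin by (rule card_UN_le)
  also have "\<dots> \<le> (\<Sum>s\<in>shifts r d a F. d)" using fib_le by (intro sum_mono)
  finally show ?thesis by (simp add: mult.commute)
qed

section \<open>Indicators centered at the overall probability and their second moment\<close>

definition rooted_centered :: "nat \<Rightarrow> nat \<Rightarrow> 'a \<Rightarrow> 'a list \<Rightarrow> 'a mpoly \<Rightarrow> real" where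
  "rooted_centered r d c a F = of_bool (has_zero r d a F) - real (card (rooted d c)) / real (order R ^ d)"

lemma abs_rooted_centered_le: "\<bar>rooted_centered r d c a F\<bar> \<le> 1"
proof -
  have "card (rooted d c) \<le> order R ^ d"
    unfolding card_coeffs[symmetric] by (rule card_mono) (auto simp: rooted_def)
  then have "real (card (rooted d c)) / real (order R ^ d) \<le> 1"
    using order_ge_2 by (simp add: divide_le_eq_1 flip: of_nat_power)
  moreover have "0 \<le> real (card (rooted d c)) / real (order R ^ d)" by simp
  ultimately show ?thesis by (auto simp: rooted_centered_def of_bool_def)
qed

lemma has_zero_iff_rooted:
  assumes F: "F \<in> with_lead r d c" and a: "a \<in> affine_space R (r - 1)" and r: "r > 0" and c: "c \<in> carrier R"
  shows "has_zero r d a F \<longleftrightarrow> (\<lambda>k\<in>{..<d}. strip_poly R r F a k) \<in> rooted d c"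
proof -
  let ?h = "\<lambda>k\<in>{..<d}. strip_poly R r F a k"
  have Fm: "F \<in> mpolys R r d" using F by (simp add: with_lead_def)
  have h: "?h \<in> coeffs d"
    unfolding coeffs_def restrict_PiE_iff using strip_poly_closed[OF Fm a] by blast
  have "poly_eval d (?h(d := c)) t = poly_eval d (strip_poly R r F a) t" if "t \<in> carrier R" for t
    using strip_poly_with_lead[OF F a r] strip_poly_closed[OF Fm a] that by (intro poly_eval_cong) auto
  then show ?thesis using h by (auto simp: has_zero_def rooted_def zeros_def)
qed

text \<open>The product of \<open>l\<close> and a univariate polynomial in the last variable, built
  one power at a time. Since \<open>l\<close> is linear, its product with the \<open>j\<close>-th
  power has degree at most \<open>j + 1 \<le> d\<close> for \<open>j < n\<close>.\<close>

lemma ex_strip_multiple: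
  assumes l: "\<And>k. column r (Suc k) k l" and n: "n \<le> d" and h: "\<And>j. j < n \<Longrightarrow> h j \<in> carrier R"
  shows "\<exists>G\<in>mpolys R r d. \<forall>a\<in>affine_space R (r - 1). \<forall>j.
    strip_poly R r G a j = (if j < n then h j \<otimes> l a else \<zero>)"
  using n h
proof (induction n)
  case 0
  have z: "indexed_const \<zero> \<in> mpolys R r d" using const_mem_mpolys[OF zero_closed] .
  have "strip_poly R r (indexed_const \<zero>) a j = \<zero>" if "a \<in> affine_space R (r - 1)" for a j
    unfolding strip_poly_eq[OF z that]
    by (rule add.finprod_one_eqI) (use that in \<open>auto simp: indexed_const_def\<close>)
  then show ?case using z by (intro bexI[of _ "indexed_const \<zero>"]) auto
next
  case (Suc n)
  then obtain G where G: "G \<in> mpolys R r d"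
    "\<And>a j. a \<in> affine_space R (r - 1) \<Longrightarrow> strip_poly R r G a j = (if j < n then h j \<otimes> l a else \<zero>)"
    by auto
  have hn: "h n \<in> carrier R" using Suc.prems by simp
  have "column r d n (\<lambda>a. h n \<otimes> l a)"
    using column_mono[OF column_scale[OF l hn]] Suc.prems(1) by simp
  then obtain G' where G': "G' \<in> mpolys R r d"
    "\<And>a j. a \<in> affine_space R (r - 1) \<Longrightarrow> strip_poly R r G' a j = (if j = n then h n \<otimes> l a else \<zero>)"
    by (auto simp: column_def)
  have "strip_poly R r (indexed_padd G G') a j = (if j < Suc n then h j \<otimes> l a else \<zero>)"
    if a: "a \<in> affine_space R (r - 1)" for a j
    unfolding strip_poly_padd[OF G(1) G'(1) a] G(2)[OF a] G'(2)[OF a]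
    using Suc.prems(2)[of j] hn column_closed[OF l a] by (auto simp: less_Suc_eq)
  then show ?case using padd_mem_mpolys[OF G(1) G'(1)] by blast
qed

text \<open>Pairwise independence: with a linear \<open>l\<close> that vanishes at \<open>y\<close>
  but not at \<open>x\<close>, translating by \<open>l\<close> times all univariate polynomials of
  degree below \<open>d\<close> spreads the lower coefficients at \<open>x\<close> uniformly over
  \<open>coeffs d\<close> and changes nothing at \<open>y\<close>.\<close>

lemma sum_rooted_centered_mult:
  assumes r: "r > 0" and d: "d > 0" and c: "c \<in> carrier R"
    and x: "x \<in> affine_space R (r - 1)" and y: "y \<in> affine_space R (r - 1)" and xy: "x \<noteq> y"
  shows "(\<Sum>F\<in>with_lead r d c. rooted_centered r d c x F * rooted_centered r d c y F) = 0"
proof -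
  obtain l0 where l0: "\<And>e k Q. column r e k Q \<Longrightarrow> column r (Suc e) k (\<lambda>a. l0 a \<otimes> Q a)"
    "\<And>a. a \<in> affine_space R (r - 1) \<Longrightarrow> l0 a \<in> carrier R" "l0 x \<noteq> \<zero>" "l0 y = \<zero>"
    by (rule column_separate[OF x y xy], rule that)
  define l where "l = (\<lambda>a. l0 a \<otimes> \<one>)"
  have l: "column r (Suc k) k l" for k
    unfolding l_def using column_power[OF r] by (intro l0(1))
  have lx: "l x \<in> carrier R" "l x \<noteq> \<zero>" "l y = \<zero>" using l0 x y by (auto simp: l_def)
  have "\<exists>G. \<forall>h\<in>coeffs d. G h \<in> mpolys R r d \<and> (\<forall>a\<in>affine_space R (r - 1). \<forall>j.
      strip_poly R r (G h) a j = (if j < d then h j \<otimes> l a else \<zero>))"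
  proof (rule bchoice, rule ballI)
    fix h assume h: "h \<in> coeffs d"
    have "h j \<in> carrier R" if "j < d" for j
      using h PiE_mem that unfolding coeffs_def by fastforce
    from ex_strip_multiple[of r l d d h, OF l order_refl this]
    show "\<exists>G. G \<in> mpolys R r d \<and> (\<forall>a\<in>affine_space R (r - 1). \<forall>j.
      strip_poly R r G a j = (if j < d then h j \<otimes> l a else \<zero>))" by blast
  qed
  then obtain G where G: "\<And>h. h \<in> coeffs d \<Longrightarrow> G h \<in> mpolys R r d"
    "\<And>h a j. h \<in> coeffs d \<Longrightarrow> a \<in> affine_space R (r - 1) \<Longrightarrow>
      strip_poly R r (G h) a j = (if j < d then h j \<otimes> l a else \<zero>)" by blast
  have G0: "G h \<in> with_lead r d \<zero>" if "h \<in> coeffs d" for h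
    using strip_poly_top[OF G(1)[OF that] x r] G[OF that] x by (simp add: with_lead_def)
  have mem: "F \<in> mpolys R r d" if "F \<in> with_lead r d c" for F
    using that by (simp add: with_lead_def)
  have hj: "h j \<in> carrier R" if "h \<in> coeffs d" "j < d" for h j
    using that PiE_mem[of h "{..<d}" "\<lambda>_. carrier R" j] by (simp add: coeffs_def)
  have "(\<Sum>F\<in>with_lead r d c. rooted_centered r d c x F * rooted_centered r d c y F)
      = 0 * (\<Sum>F\<in>with_lead r d c. rooted_centered r d c y F)"
  proof (rule sum_translation_average[where H = "coeffs d" and T = "\<lambda>h F. indexed_padd F (G h)"])
    have "(\<lambda>k\<in>{..<d}. \<zero>) \<in> coeffs d" unfolding coeffs_def restrict_PiE_iff by blast
    then show "coeffs d \<noteq> {}" by blast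
    fix h assume h: "h \<in> coeffs d"
    show "(\<lambda>F. indexed_padd F (G h)) ` with_lead r d c \<subseteq> with_lead r d c"
      using padd_mem_with_lead[OF _ G0[OF h] c] by blast
    show "inj_on (\<lambda>F. indexed_padd F (G h)) (with_lead r d c)"
      by (rule inj_on_subset[OF inj_on_padd[OF G(1)[OF h]]]) (auto simp: with_lead_def)
    fix F assume F: "F \<in> with_lead r d c"
    have "strip_poly R r (indexed_padd F (G h)) y j = strip_poly R r F y j" for j
      unfolding strip_poly_padd[OF mem[OF F] G(1)[OF h] y] G(2)[OF h y]
      using lx hj[OF h] strip_poly_closed[OF mem[OF F] y] by simp
    then have "strip_poly R r (indexed_padd F (G h)) y = strip_poly R r F y" by (rule ext)
    then show "rooted_centered r d c y (indexed_padd F (G h)) = rooted_centered r d c y F"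
      by (simp add: rooted_centered_def has_zero_def)
  next
    fix F assume F: "F \<in> with_lead r d c"
    let ?f = "strip_poly R r F x"
    \<comment> \<open>\<open>\<beta>\<close> sends \<open>h\<close> to the lower coefficients of the
      translated strip polynomial at \<open>x\<close>; it is bijective because
      \<open>l x \<noteq> \<zero>\<close>.\<close>
    define \<beta> where "\<beta> = (\<lambda>h. \<lambda>k\<in>{..<d}. ?f k \<oplus> h k \<otimes> l x)"
    have fcl: "?f k \<in> carrier R" for k using strip_poly_closed[OF mem[OF F] x] .
    have bij: "bij_betw \<beta> (coeffs d) (coeffs d)"
    proof -
      have inj: "inj_on \<beta> (coeffs d)"
      proof (rule inj_onI)
        fix h h' assume h: "h \<in> coeffs d" "h' \<in> coeffs d" and eq: "\<beta> h = \<beta> h'"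
        show "h = h'"
        proof (rule PiE_ext)
          show "h \<in> {..<d} \<rightarrow>\<^sub>E carrier R" "h' \<in> {..<d} \<rightarrow>\<^sub>E carrier R" using h by (auto simp: coeffs_def)
          fix k assume k: "k \<in> {..<d}"
          then have "h k \<otimes> l x = h' k \<otimes> l x"
            using fun_cong[OF eq, of k] fcl hj[OF h(1), of k] hj[OF h(2), of k] lx by (simp add: \<beta>_def)
          then show "h k = h' k"
            using m_rcancel[OF lx(2,1)] hj[OF h(1), of k] hj[OF h(2), of k] k by simp
        qed
      qed
      moreover have "\<beta> ` coeffs d \<subseteq> coeffs d"
      proof (rule image_subsetI)
        fix h assume "h \<in> coeffs d"
        then show "\<beta> h \<in> coeffs d"
          using fcl hj lx(1) unfolding \<beta>_def coeffs_def restrict_PiE_iff by blast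
      qed
      ultimately show ?thesis unfolding bij_betw_def using endo_inj_surj[OF finite_coeffs] by blast
    qed
    have "(\<Sum>h\<in>coeffs d. of_bool (has_zero r d x (indexed_padd F (G h)))) =
        (\<Sum>h\<in>coeffs d. of_bool (\<beta> h \<in> rooted d c) :: real)"
    proof (intro sum.cong refl arg_cong[where f = of_bool])
      fix h assume h: "h \<in> coeffs d"
      have "indexed_padd F (G h) \<in> with_lead r d c" using padd_mem_with_lead[OF F G0[OF h] c] .
      from has_zero_iff_rooted[OF this x r c]
      have "has_zero r d x (indexed_padd F (G h)) \<longleftrightarrow>
          (\<lambda>k\<in>{..<d}. strip_poly R r (indexed_padd F (G h)) x k) \<in> rooted d c" .
      also have "(\<lambda>k\<in>{..<d}. strip_poly R r (indexed_padd F (G h)) x k) = \<beta> h"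
        unfolding \<beta>_def strip_poly_padd[OF mem[OF F] G(1)[OF h] x] G(2)[OF h x]
        by (auto simp: restrict_def)
      finally show "has_zero r d x (indexed_padd F (G h)) = (\<beta> h \<in> rooted d c)" .
    qed
    also have "\<dots> = (\<Sum>h\<in>coeffs d. of_bool (h \<in> rooted d c))"
      by (rule sum.reindex_bij_betw[OF bij, where g = "\<lambda>h. of_bool (h \<in> rooted d c)"])
    also have "\<dots> = real (card {h \<in> coeffs d. h \<in> rooted d c})"
      by (rule card_filter_eq_sum[OF finite_coeffs, symmetric])
    also have "{h \<in> coeffs d. h \<in> rooted d c} = rooted d c" by (auto simp: rooted_def)
    finally show "(\<Sum>h\<in>coeffs d. rooted_centered r d c x (indexed_padd F (G h))) = real (card (coeffs d)) * 0"
      using order_ge_2 by (simp add: rooted_centered_def sum_subtractf card_coeffs)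
  qed auto
  then show ?thesis by simp
qed

lemma rooted_centered_second_moment:
  assumes r: "r > 0" and d: "d > 0" and c: "c \<in> carrier R"
  shows "(\<Sum>F\<in>with_lead r d c. (\<Sum>a\<in>affine_space R (r - 1). rooted_centered r d c a F)\<^sup>2)
    \<le> real (card (with_lead r d c)) * real (order R ^ (r - 1))"
proof -
  have "(\<Sum>F\<in>with_lead r d c. (\<Sum>a\<in>affine_space R (r - 1). rooted_centered r d c a F)\<^sup>2)
    \<le> real (card (with_lead r d c)) * real (card (affine_space R (r - 1)))"
    using sum_rooted_centered_mult[OF r d c] abs_rooted_centered_le
    by (intro second_moment_le) auto
  then show ?thesis by (simp add: card_affine_space)
qed

text \<open>Adding a multiple of the \<open>d\<close>-th power of the last variable maps each class
  injectively into any other, so the \<open>order R\<close> classes have equal size.\<close>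

lemma card_with_lead:
  assumes r: "r > 0" and c: "c \<in> carrier R"
  shows "card (mpolys R r d) = order R * card (with_lead r d c)"
proof -
  have le: "card (with_lead r d u) \<le> card (with_lead r d v)"
    if uv: "u \<in> carrier R" "v \<in> carrier R" for u v
  proof -
    obtain a where a: "a \<in> affine_space R (r - 1)" using affine_space_nonempty by blast
    have "column r d d (\<lambda>a. (v \<ominus> u) \<otimes> \<one>)"
      using uv column_power[OF r] by (intro column_scale) auto
    then obtain G where G: "G \<in> mpolys R r d" "strip_poly R r G a d = v \<ominus> u"
      using a uv unfolding column_def by fastforce
    have top: "G (replicate_mset d (r - 1)) = v \<ominus> u"
      using strip_poly_top[OF G(1) a r] G(2) by simp
    have "u \<oplus> (v \<ominus> u) = v" using uv by algebra
    then have "(\<lambda>F. indexed_padd F G) ` with_lead r d u \<subseteq> with_lead r d v"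
      using padd_mem_mpolys[OF _ G(1)] top by (auto simp: with_lead_def indexed_padd_def)
    moreover have "inj_on (\<lambda>F. indexed_padd F G) (with_lead r d u)"
      by (rule inj_on_subset[OF inj_on_padd[OF G(1)]]) (auto simp: with_lead_def)
    ultimately show ?thesis using finite_with_lead by (intro card_inj_on_le)
  qed
  have "mpolys R r d = (\<Union>u\<in>carrier R. with_lead r d u)"
    using mpolysD(1) by (auto simp: with_lead_def)
  moreover have "card (\<Union>u\<in>carrier R. with_lead r d u) = (\<Sum>u\<in>carrier R. card (with_lead r d u))"
    using finite_carrier by (intro card_UN_disjoint) (auto simp: with_lead_def)
  ultimately have "card (mpolys R r d) = (\<Sum>u\<in>carrier R. card (with_lead r d u))" by (rule trans[OF arg_cong])
  also have "\<dots> = (\<Sum>u\<in>carrier R. card (with_lead r d c))"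
    using le c by (intro sum.cong refl le_antisym) auto
  finally show ?thesis by (simp add: order_def)
qed

subsection \<open>The average cost\<close>

definition num_good :: "nat \<Rightarrow> nat \<Rightarrow> 'a mpoly \<Rightarrow> nat" where
  "num_good r d F = card {a \<in> affine_space R (r - 1). has_zero r d a F}"

lemma num_good_eq_sum:
  "real (num_good r d F) = (\<Sum>a\<in>affine_space R (r - 1). of_bool (has_zero r d a F))"
  unfolding num_good_def by (rule card_filter_eq_sum) simp

lemma sum_rooted_centered:
  "(\<Sum>a\<in>affine_space R (r - 1). rooted_centered r d c a F) =
    real (num_good r d F) - real (card (rooted d c)) / real (order R ^ d) * real (order R ^ (r - 1))"
  by (simp add: rooted_centered_def sum_subtractf num_good_eq_sum card_affine_space)

text \<open>Over the constant term alone, each strip has a zero with probability at least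
  \<open>1 / d\<close>, whatever the other coefficients are. A small \<open>num_good\<close>
  therefore forces a strongly negative sum, whose probability the fourth moment controls.\<close>

lemma sum_shift_centered_le:
  assumes "F \<in> with_lead r d c" "c \<noteq> \<zero>" "r > 0" "d > 0"
  shows "(\<Sum>a\<in>affine_space R (r - 1). shift_centered r d a F)
    \<le> real (num_good r d F) - real (order R ^ (r - 1)) / real d"
proof -
  have "(\<Sum>a\<in>affine_space R (r - 1). shift_centered r d a F)
      \<le> (\<Sum>a\<in>affine_space R (r - 1). of_bool (has_zero r d a F) - 1 / real d)"
  proof (rule sum_mono)
    fix a assume "a \<in> affine_space R (r - 1)"
    then have "order R \<le> d * card (shifts r d a F)" by (rule order_le_card_shifts[OF assms])
    then have "real (order R) \<le> real d * real (card (shifts r d a F))"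
      by (metis of_nat_le_iff of_nat_mult)
    then have "1 / real d \<le> real (card (shifts r d a F)) / real (order R)"
      using assms(4) order_ge_2 by (simp add: field_simps)
    then show "shift_centered r d a F \<le> of_bool (has_zero r d a F) - 1 / real d"
      by (simp add: shift_centered_def)
  qed
  also have "\<dots> = real (num_good r d F) - real (order R ^ (r - 1)) / real d"
    by (simp add: sum_subtractf num_good_eq_sum card_affine_space)
  finally show ?thesis .
qed

lemma rooted_prob_eq:
  assumes "0 < d" "d \<le> order R" "c \<in> carrier R" "c \<noteq> \<zero>"
  shows "real (card (rooted d c)) / real (order R ^ d) = root_prob d (order R)"
  unfolding card_rooted[OF assms] root_prob_def sum_divide_distrib
proof (intro sum.cong refl)
  fix j assume "j \<in> {1..d}"
  then have "real (order R) ^ d = real (order R) ^ j * real (order R) ^ (d - j)"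
    by (simp flip: power_add)
  then show "(- 1) ^ (j - 1) * real ((order R choose j) * order R ^ (d - j)) / real (order R ^ d) =
      (- 1) ^ (j - 1) * (real (order R choose j) / real (order R) ^ j)"
    using order_ge_2 by simp
qed

text \<open>Sums \<open>inverse_count_le_moments\<close> with \<open>D = d\<close> over the class
  and inserts the second and fourth moments.\<close>

lemma sum_with_lead_nonzero_le:
  assumes r: "r > 0" and d: "2 \<le> d" "d \<le> order R" and c: "c \<in> carrier R" "c \<noteq> \<zero>"
    and p: "p = root_prob d (order R)" "p > 0" and \<delta>: "0 < \<delta>" "\<delta> < 1"
    and M: "M = real (order R ^ (r - 1))"
  shows "(\<Sum>F\<in>with_lead r d c. (M + 1) / (real (num_good r d F) + 1)) \<le>
    real (card (with_lead r d c)) *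
    ((M + 1) / ((1 - \<delta>) * p * M) + (M + 1) * (2 * real d / M) * (M / (\<delta> * p * M)\<^sup>2)
      + (M + 1) * (M\<^sup>2 * (real (order R) + 1) / (M / (2 * real d)) ^ 4))"
proof -
  let ?A = "with_lead r d c"
  define s where "s = (\<lambda>F. \<Sum>a\<in>affine_space R (r - 1). shift_centered r d a F)"
  define u where "u = (\<lambda>F. real (num_good r d F) - p * M)"
  have M0: "M > 0" using order_ge_2 by (simp add: M)
  have u: "u F = (\<Sum>a\<in>affine_space R (r - 1). rooted_centered r d c a F)" for F
    unfolding u_def p(1) M sum_rooted_centered using rooted_prob_eq[OF _ d(2) c] d(1) by simp
  have "(\<Sum>F\<in>?A. (M + 1) / (real (num_good r d F) + 1)) \<le>
      (\<Sum>F\<in>?A. (M + 1) / ((1 - \<delta>) * p * M) + (M + 1) * (2 * real d / M) * ((u F)\<^sup>2 / (\<delta> * p * M)\<^sup>2)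
        + (M + 1) * (s F ^ 4 / (M / (2 * real d)) ^ 4))"
  proof (rule sum_mono)
    fix F assume F: "F \<in> ?A"
    show "(M + 1) / (real (num_good r d F) + 1) \<le> (M + 1) / ((1 - \<delta>) * p * M)
        + (M + 1) * (2 * real d / M) * ((u F)\<^sup>2 / (\<delta> * p * M)\<^sup>2)
        + (M + 1) * (s F ^ 4 / (M / (2 * real d)) ^ 4)"
      unfolding u_def
      using sum_shift_centered_le[OF F c(2) r] d M0 p(2) \<delta>
      by (intro inverse_count_le_moments) (auto simp: s_def M)
  qed
  also have "\<dots> = real (card ?A) * ((M + 1) / ((1 - \<delta>) * p * M))
      + (M + 1) * (2 * real d / M) * ((\<Sum>F\<in>?A. (u F)\<^sup>2) / (\<delta> * p * M)\<^sup>2)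
      + (M + 1) * ((\<Sum>F\<in>?A. s F ^ 4) / (M / (2 * real d)) ^ 4)"
    by (simp only: sum.distrib sum_constant sum_distrib_left[symmetric] sum_divide_distrib[symmetric])
  also have "\<dots> \<le> real (card ?A) * ((M + 1) / ((1 - \<delta>) * p * M))
      + (M + 1) * (2 * real d / M) * (real (card ?A) * M / (\<delta> * p * M)\<^sup>2)
      + (M + 1) * (real (card ?A) * M\<^sup>2 * (real (order R) + 1) / (M / (2 * real d)) ^ 4)"
  proof (intro add_mono order_refl mult_left_mono divide_right_mono)
    show "(\<Sum>F\<in>?A. (u F)\<^sup>2) \<le> real (card ?A) * M"
      unfolding u M using d c by (intro rooted_centered_second_moment r) auto
    show "(\<Sum>F\<in>?A. s F ^ 4) \<le> real (card ?A) * M\<^sup>2 * (real (order R) + 1)"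
      unfolding s_def M by (intro shift_centered_fourth_moment r d c)
  qed (use M0 in auto)
  also have "\<dots> = real (card ?A) *
    ((M + 1) / ((1 - \<delta>) * p * M) + (M + 1) * (2 * real d / M) * (M / (\<delta> * p * M)\<^sup>2)
      + (M + 1) * (M\<^sup>2 * (real (order R) + 1) / (M / (2 * real d)) ^ 4))"
    by (simp only: divide_inverse algebra_simps)
  finally show ?thesis .
qed

text \<open>Here the probability of a zero is at least \<open>1 / (2 * d)\<close>, and the second
  moment alone yields a bounded mean. This suffices for a class with share
  \<open>1 / order R\<close>.\<close>

lemma sum_with_lead_zero_le:
  assumes r: "r > 0" and d: "2 \<le> d" "d \<le> order R" and M: "M = real (order R ^ (r - 1))"
  shows "(\<Sum>F\<in>with_lead r d \<zero>. (M + 1) / (real (num_good r d F) + 1)) \<le>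
    real (card (with_lead r d \<zero>)) * ((M + 1) / M * (4 * real d + 16 * (real d)\<^sup>2))"
proof -
  let ?A = "with_lead r d \<zero>"
  define p where "p = real (card (rooted d \<zero>)) / real (order R ^ d)"
  define u where "u = (\<lambda>F. real (num_good r d F) - p * M)"
  have M0: "M > 0" using order_ge_2 by (simp add: M)
  have "real (order R ^ d) \<le> real (2 * d * card (rooted d \<zero>))"
    using card_rooted_zero_ge[OF d] by (simp only: of_nat_le_iff)
  then have pd: "1 / (2 * real d) \<le> p"
    using order_ge_2 d by (simp add: p_def field_simps)
  then have p0: "p > 0" using d by (metis le_zero_eq less_le_trans not_gr_zero of_nat_0_less_iff
        zero_less_divide_1_iff zero_less_mult_iff zero_less_numeral zero_neq_numeral)
  have pinv: "1 / p \<le> 2 * real d" using pd p0 d by (simp add: field_simps)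
  have u: "u F = (\<Sum>a\<in>affine_space R (r - 1). rooted_centered r d \<zero> a F)" for F
    unfolding u_def p_def M sum_rooted_centered ..
  have "(\<Sum>F\<in>?A. (M + 1) / (real (num_good r d F) + 1)) \<le>
      (\<Sum>F\<in>?A. (M + 1) / (p * M / 2) + (M + 1) * (u F)\<^sup>2 / (p * M / 2)\<^sup>2)"
    unfolding u_def using M0 p0 by (intro sum_mono inverse_count_le_second_moment) auto
  also have "\<dots> = real (card ?A) * ((M + 1) / (p * M / 2)) + (M + 1) * (\<Sum>F\<in>?A. (u F)\<^sup>2) / (p * M / 2)\<^sup>2"
    by (simp only: sum.distrib sum_constant sum_distrib_left[symmetric] sum_divide_distrib[symmetric])
  also have "\<dots> \<le> real (card ?A) * ((M + 1) / (p * M / 2)) + (M + 1) * (real (card ?A) * M) / (p * M / 2)\<^sup>2"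
  proof (intro add_mono order_refl mult_left_mono divide_right_mono)
    show "(\<Sum>F\<in>?A. (u F)\<^sup>2) \<le> real (card ?A) * M"
      unfolding u M using d by (intro rooted_centered_second_moment r) auto
  qed (use M0 in auto)
  also have "\<dots> = real (card ?A) * ((M + 1) / M * (2 * (1 / p) + 4 * (1 / p)\<^sup>2))"
    using M0 p0 by (simp add: field_simps power2_eq_square)
  also have "\<dots> \<le> real (card ?A) * ((M + 1) / M * (2 * (2 * real d) + 4 * (2 * real d)\<^sup>2))"
    using M0 p0 pinv by (intro mult_left_mono add_mono power_mono) auto
  finally show ?thesis by (simp add: power_mult_distrib)
qed

lemma sum_mpolys_le:
  assumes r: "r > 2" and d: "2 \<le> d" "d \<le> order R"
    and p: "root_prob d (order R) > 0" and \<delta>: "0 < \<delta>" "\<delta> < 1"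
  shows "(\<Sum>F\<in>mpolys R r d. (real (order R ^ (r - 1)) + 1) / (real (num_good r d F) + 1)) \<le>
    real (card (mpolys R r d)) * search_bound \<delta> d (order R)"
proof -
  define M where "M = real (order R ^ (r - 1))"
  define q where "q = real (order R)"
  define p where "p = root_prob d (order R)"
  define L where "L = real (card (with_lead r d \<zero>))"
  have r0: "r > 0" using r by simp
  have q2: "q \<ge> 2" using order_ge_2 by (simp add: q_def)
  have p0: "p > 0" using p by (simp add: p_def)
  \<comment> \<open>This is where \<open>r > 2\<close> enters: the fourth moment contributes a
    multiple of \<open>(q + 1) / M\<close>, which tends to zero because \<open>M\<close> is at least
    the square of \<open>q\<close>.\<close>
  have Mq: "q\<^sup>2 \<le> M"
  proof -
    have "q\<^sup>2 \<le> q ^ (r - 1)" using q2 r by (intro power_increasing) auto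
    then show ?thesis by (simp add: M_def q_def)
  qed
  have q20: "q\<^sup>2 > 0" using q2 by simp
  then have M0: "M > 0" using Mq by linarith
  have M1: "M \<ge> 1" using Mq q2 one_le_power[of q 2] by linarith
  have invM: "1 / M \<le> 1 / q\<^sup>2" using Mq q20 M0 by (intro divide_left_mono) auto
  also have "\<dots> \<le> 1 / q" using q2 by (simp add: field_simps power2_eq_square)
  finally have invM': "1 / M \<le> 1 / q" .
  have M2: "(M + 1) / M \<le> 2" using M1 by (simp add: field_simps)
  have Leq: "real (card (with_lead r d c)) = L" if "c \<in> carrier R" for c
    using card_with_lead[OF r0 that, of d] card_with_lead[OF r0 zero_closed, of d] order_ge_2
    by (simp add: L_def)
  have cardm: "real (card (mpolys R r d)) = q * L"
    using card_with_lead[OF r0 zero_closed, of d] by (simp add: q_def L_def)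
  define U where "U = (1 + 1 / q) / ((1 - \<delta>) * p) + 4 * real d / (\<delta>\<^sup>2 * p\<^sup>2 * q\<^sup>2) + 32 * real d ^ 4 * (q + 1) / q\<^sup>2"
  have U0: "U \<ge> 0" using q2 \<delta> p0 by (simp add: U_def)
  have nonzero: "(\<Sum>F\<in>with_lead r d c. (M + 1) / (real (num_good r d F) + 1)) \<le> L * U"
    if c: "c \<in> carrier R" "c \<noteq> \<zero>" for c
  proof -
    have "(\<Sum>F\<in>with_lead r d c. (M + 1) / (real (num_good r d F) + 1)) \<le>
      L * ((M + 1) / ((1 - \<delta>) * p * M) + (M + 1) * (2 * real d / M) * (M / (\<delta> * p * M)\<^sup>2)
      + (M + 1) * (M\<^sup>2 * (q + 1) / (M / (2 * real d)) ^ 4))"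
      using sum_with_lead_nonzero_le[OF r0 d c p_def p0 \<delta> M_def] Leq[OF c(1)] by (simp add: q_def)
    also have "\<dots> \<le> L * U"
      unfolding U_def
    proof (intro mult_left_mono add_mono)
      have "(M + 1) / ((1 - \<delta>) * p * M) = (1 + 1 / M) / ((1 - \<delta>) * p)"
        using M0 p0 \<delta> by (simp add: field_simps)
      also have "\<dots> \<le> (1 + 1 / q) / ((1 - \<delta>) * p)"
        using invM' p0 \<delta> by (intro divide_right_mono add_mono) auto
      finally show "(M + 1) / ((1 - \<delta>) * p * M) \<le> (1 + 1 / q) / ((1 - \<delta>) * p)" .
      have "(M + 1) * (2 * real d / M) * (M / (\<delta> * p * M)\<^sup>2) = 2 * real d / (\<delta>\<^sup>2 * p\<^sup>2) * ((M + 1) / M * (1 / M))"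
        using M0 p0 \<delta> by (simp add: field_simps power2_eq_square)
      also have "\<dots> \<le> 2 * real d / (\<delta>\<^sup>2 * p\<^sup>2) * (2 * (1 / q\<^sup>2))"
        using M0 M2 invM by (intro mult_left_mono mult_mono) auto
      also have "\<dots> = 4 * real d / (\<delta>\<^sup>2 * p\<^sup>2 * q\<^sup>2)" by simp
      finally show "(M + 1) * (2 * real d / M) * (M / (\<delta> * p * M)\<^sup>2) \<le> 4 * real d / (\<delta>\<^sup>2 * p\<^sup>2 * q\<^sup>2)" .
      have "(M + 1) * (M\<^sup>2 * (q + 1) / (M / (2 * real d)) ^ 4) =
          16 * real d ^ 4 * (q + 1) * ((M + 1) / M * (1 / M))"
        using M0 d by (simp add: field_simps power2_eq_square power4_eq_xxxx)
      also have "\<dots> \<le> 16 * real d ^ 4 * (q + 1) * (2 * (1 / q\<^sup>2))"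
        using M0 M2 invM q2 by (intro mult_left_mono mult_mono) auto
      also have "\<dots> = 32 * real d ^ 4 * (q + 1) / q\<^sup>2" by simp
      finally show "(M + 1) * (M\<^sup>2 * (q + 1) / (M / (2 * real d)) ^ 4) \<le> 32 * real d ^ 4 * (q + 1) / q\<^sup>2" .
    qed (simp add: L_def)
    finally show ?thesis .
  qed
  have zero: "(\<Sum>F\<in>with_lead r d \<zero>. (M + 1) / (real (num_good r d F) + 1)) \<le> L * (8 * real d + 32 * (real d)\<^sup>2)"
  proof -
    have "(\<Sum>F\<in>with_lead r d \<zero>. (M + 1) / (real (num_good r d F) + 1)) \<le>
        L * ((M + 1) / M * (4 * real d + 16 * (real d)\<^sup>2))"
      using sum_with_lead_zero_le[OF r0 d M_def] by (simp add: L_def)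
    also have "\<dots> \<le> L * (2 * (4 * real d + 16 * (real d)\<^sup>2))"
      using M2 by (intro mult_left_mono mult_right_mono) (auto simp: L_def)
    finally show ?thesis by simp
  qed
  have "mpolys R r d = (\<Union>c\<in>carrier R. with_lead r d c)"
    using mpolysD(1) by (auto simp: with_lead_def)
  then have "(\<Sum>F\<in>mpolys R r d. (M + 1) / (real (num_good r d F) + 1)) =
      (\<Sum>F\<in>(\<Union>c\<in>carrier R. with_lead r d c). (M + 1) / (real (num_good r d F) + 1))"
    by (rule arg_cong)
  also have "\<dots> = (\<Sum>c\<in>carrier R. \<Sum>F\<in>with_lead r d c. (M + 1) / (real (num_good r d F) + 1))"
    using finite_carrier by (intro sum.UNION_disjoint) (auto simp: with_lead_def)
  \<comment> \<open>Only one of the \<open>q\<close> equally large classes, that of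
    \<open>c = \<zero>\<close>, carries the extra constant, which therefore gets the weight
    \<open>1 / q\<close>.\<close>
  also have "\<dots> \<le> (\<Sum>c\<in>carrier R. L * U + (if c = \<zero> then L * (8 * real d + 32 * (real d)\<^sup>2) else 0))"
  proof (rule sum_mono)
    fix c assume c: "c \<in> carrier R"
    have "L * U \<ge> 0" using U0 by (simp add: L_def)
    then show "(\<Sum>F\<in>with_lead r d c. (M + 1) / (real (num_good r d F) + 1)) \<le>
        L * U + (if c = \<zero> then L * (8 * real d + 32 * (real d)\<^sup>2) else 0)"
      using zero nonzero[OF c] by (cases "c = \<zero>") auto
  qed
  also have "\<dots> = q * L * U + L * (8 * real d + 32 * (real d)\<^sup>2)"
    using finite_carrier by (simp add: sum.distrib q_def order_def)
  also have "\<dots> = q * L * ((8 * real d + 32 * (real d)\<^sup>2) / q + U)"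
    using q2 by (simp add: field_simps)
  also have "(8 * real d + 32 * (real d)\<^sup>2) / q + U = search_bound \<delta> d (order R)"
    by (simp add: search_bound_def U_def p_def q_def)
  finally show ?thesis by (simp add: cardm M_def)
qed

section \<open>From the number of strips to the number of operations\<close>

lemma strip_ops_le_tau:
  assumes "F \<in> mpolys R r d" "\<omega> \<in> affine_space R n" "a \<in> affine_space R (r - 1)"
  shows "strip_ops R r S F \<omega> a \<le> tau R r d n S"
proof -
  let ?X = "{strip_ops R r S F \<omega> a | F \<omega> a.
     F \<in> mpolys R r d \<and> \<omega> \<in> affine_space R n \<and> a \<in> affine_space R (r - 1)}"
  \<comment> \<open>As an image of a finite product the set is finite, so \<open>Max\<close> is an
    upper bound for it.\<close>
  have "?X = (\<lambda>(F, \<omega>, a). strip_ops R r S F \<omega> a) ` (mpolys R r d \<times> affine_space R n \<times> affine_space R (r - 1))"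
    by force
  then have "finite ?X" by simp
  then show ?thesis unfolding tau_def using assms by (intro Max_ge) blast+
qed

lemma svs_ops_le:
  assumes "F \<in> mpolys R r d" "\<omega> \<in> affine_space R n" "set as \<subseteq> affine_space R (r - 1)"
  shows "svs_ops R r S as F \<omega> \<le> tau R r d n S * searched (\<lambda>a. \<not> gcd_is_one R r F a) as"
  using assms(3)
proof (induction as)
  case (Cons a as)
  have "strip_ops R r S F \<omega> a \<le> tau R r d n S"
    using Cons.prems by (intro strip_ops_le_tau assms) auto
  then show ?case
    using Cons by (auto simp: svs_ops_def split: prod.splits)
qed (simp add: svs_ops_def)

text \<open>A duplicate-free list of \<open>order R ^ (r - 1)\<close> strips must contain all of
  them, so the choice of strips is a uniformly random order.\<close>

lemma strip_choices_eq: "strip_choices R r = permutations_of_set (affine_space R (r - 1))"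
proof -
  have "set as = affine_space R (r - 1)"
    if "set as \<subseteq> affine_space R (r - 1)" "distinct as" "length as = order R ^ (r - 1)" for as
    using that by (intro card_subset_eq) (auto simp: distinct_card card_affine_space)
  then show ?thesis
    unfolding strip_choices_def permutations_of_set_def
    by (auto simp: distinct_card card_affine_space dest: distinct_card[symmetric])
qed

lemma has_zero_imp_not_gcd_is_one:
  assumes F: "F \<in> mpolys R r d" and a: "a \<in> affine_space R (r - 1)" and z: "has_zero r d a F"
  shows "\<not> gcd_is_one R r F a"
proof -
  obtain t where "t \<in> carrier R" "poly_eval d (strip_poly R r F a) t = \<zero>"
    using z by (auto simp: has_zero_def)
  then show ?thesis
    using not_gcd_is_one[of r F a d t] strip_poly_closed[OF F a] strip_poly_above[OF F a] by blast
qed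

text \<open>The search stops in every strip with a zero; replacing the number of stopping strips by
  the possibly smaller \<open>num_good\<close> only enlarges the bound.\<close>

lemma sum_searched_le:
  assumes F: "F \<in> mpolys R r d"
  shows "(\<Sum>as\<in>strip_choices R r. real (searched (\<lambda>a. \<not> gcd_is_one R r F a) as)) \<le>
    real (card (strip_choices R r)) * ((real (order R ^ (r - 1)) + 1) / (real (num_good r d F) + 1))"
proof -
  let ?P = "affine_space R (r - 1)"
  let ?g = "card {a \<in> ?P. \<not> gcd_is_one R r F a}"
  have "num_good r d F \<le> ?g"
    unfolding num_good_def using has_zero_imp_not_gcd_is_one[OF F] by (intro card_mono) auto
  then have "(real (card ?P) + 1) / (real ?g + 1) \<le> (real (card ?P) + 1) / (real (num_good r d F) + 1)"
    by (intro divide_left_mono) auto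
  then have "fact (card ?P) * ((real (card ?P) + 1) / (real ?g + 1)) \<le>
      fact (card ?P) * ((real (card ?P) + 1) / (real (num_good r d F) + 1))"
    by (intro mult_left_mono) auto
  with sum_searched_permutations_le[OF finite_affine_space, of "\<lambda>a. \<not> gcd_is_one R r F a" "r - 1"]
  have "(\<Sum>as\<in>permutations_of_set ?P. real (searched (\<lambda>a. \<not> gcd_is_one R r F a) as)) \<le>
      fact (card ?P) * ((real (card ?P) + 1) / (real (num_good r d F) + 1))"
    by linarith
  then show ?thesis
    by (simp add: strip_choices_eq card_affine_space)
qed

lemma average_ops_le:
  assumes r: "r > 2" and d: "2 \<le> d" "d \<le> order R"
    and p: "root_prob d (order R) > 0" and \<delta>: "0 < \<delta>" "\<delta> < 1"
  shows "average_ops R r d n S \<le> real (tau R r d n S) * search_bound \<delta> d (order R)"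
proof -
  let ?C = "strip_choices R r" and ?F = "mpolys R r d" and ?W = "affine_space R n"
  define \<tau> where "\<tau> = real (tau R r d n S)"
  define nC where "nC = real (card ?C)"
  define nF where "nF = real (card ?F)"
  define nW where "nW = real (card ?W)"
  have finC: "finite ?C" by (simp add: strip_choices_eq)
  have "nC > 0" by (simp add: nC_def strip_choices_eq)
  have "nW > 0" using affine_space_nonempty by (simp add: nW_def card_gt_0_iff)
  have "nF > 0"
    using const_mem_mpolys[OF zero_closed, of r d] by (auto simp: nF_def card_gt_0_iff)
  have \<tau>0: "\<tau> \<ge> 0" by (simp add: \<tau>_def)
  have "(\<Sum>(as, F, \<omega>)\<in>?C \<times> ?F \<times> ?W. real (svs_ops R r S as F \<omega>)) \<le>
      (\<Sum>(as, F, \<omega>)\<in>?C \<times> ?F \<times> ?W. \<tau> * real (searched (\<lambda>a. \<not> gcd_is_one R r F a) as))"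
  proof (rule sum_mono, clarify)
    fix as F \<omega> assume *: "as \<in> ?C" "F \<in> ?F" "\<omega> \<in> ?W"
    then have "set as \<subseteq> affine_space R (r - 1)" by (simp add: strip_choices_def)
    from svs_ops_le[OF *(2,3) this, of S]
    show "real (svs_ops R r S as F \<omega>) \<le> \<tau> * real (searched (\<lambda>a. \<not> gcd_is_one R r F a) as)"
      unfolding \<tau>_def by (simp only: of_nat_le_iff of_nat_mult[symmetric])
  qed
  also have "\<dots> = (\<Sum>as\<in>?C. \<Sum>F\<in>?F. \<Sum>\<omega>\<in>?W. \<tau> * real (searched (\<lambda>a. \<not> gcd_is_one R r F a) as))"
    by (simp only: sum.cartesian_product[symmetric])
  \<comment> \<open>The bound does not involve \<open>\<omega>\<close>, so that sum becomes the
    factor \<open>nW\<close>. The sum over \<open>F\<close> is moved outside so that the mean over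
    the orders is taken for fixed \<open>F\<close>.\<close>
  also have "\<dots> = \<tau> * nW * (\<Sum>F\<in>?F. \<Sum>as\<in>?C. real (searched (\<lambda>a. \<not> gcd_is_one R r F a) as))"
    by (subst sum.swap) (simp add: nW_def sum_distrib_left mult_ac)
  also have "\<dots> \<le> \<tau> * nW * (\<Sum>F\<in>?F. nC * ((real (order R ^ (r - 1)) + 1) / (real (num_good r d F) + 1)))"
    using \<tau>0 \<open>nW > 0\<close> sum_searched_le unfolding nC_def by (intro mult_left_mono sum_mono) auto
  also have "\<dots> \<le> \<tau> * nW * (nC * (nF * search_bound \<delta> d (order R)))"
    unfolding sum_distrib_left[symmetric] nF_def
    using \<tau>0 \<open>nW > 0\<close> \<open>nC > 0\<close> by (intro mult_left_mono sum_mpolys_le assms) auto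
  finally have "(\<Sum>(as, F, \<omega>)\<in>?C \<times> ?F \<times> ?W. real (svs_ops R r S as F \<omega>)) \<le>
      nC * nF * nW * (\<tau> * search_bound \<delta> d (order R))" by (simp add: mult_ac)
  then have "1 / (nC * nF * nW) * (\<Sum>(as, F, \<omega>)\<in>?C \<times> ?F \<times> ?W. real (svs_ops R r S as F \<omega>)) \<le>
      \<tau> * search_bound \<delta> d (order R)"
    using \<open>nC > 0\<close> \<open>nF > 0\<close> \<open>nW > 0\<close> by (simp add: field_simps)
  then show ?thesis unfolding average_ops_def \<tau>_def nC_def nF_def nW_def .
qed

end

section \<open>Absorption of the error terms by the gap between \<open>1 / mu d\<close> and the
  claimed constant\<close>

theorem theorem4p4:
  fixes r d :: nat
  assumes "r > 2" and "d \<ge> 2"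
  shows "\<exists>err :: nat \<Rightarrow> real. err \<in> O(\<lambda>q. real q powr (- 1 / 2)) \<and>
    (\<forall>\<^sub>F q in sequentially. \<forall>(K :: 'a ring) (n :: nat) (S :: 'a search_routine).
       field K \<and> finite (carrier K) \<and> order K = q \<longrightarrow>
       average_ops K r d n S
         \<le> real (tau K r d n S) * (1 / mu d + real d * (1 - 1 / real d) ^ s_star d r) + err q)"
proof -
  define B where "B = 1 / mu d + real d * (1 - 1 / real d) ^ s_star d r"
  have mu: "mu d > 0" using mu_ge_half[OF assms(2)] by simp
  have "real d * (1 - 1 / real d) ^ s_star d r > 0"
    using assms(2) by (intro mult_pos_pos zero_less_power) auto
  then have B: "1 / mu d < B" "B > 0" using mu by (auto simp: B_def intro: add_pos_pos)
  \<comment> \<open>The choice gives \<open>1 - \<delta> = (1 + x) / 2 > x\<close>. The limit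
    \<open>1 / ((1 - \<delta>) * mu d)\<close> of \<open>search_bound \<delta> d\<close> is thus
    below \<open>1 / (x * mu d) = B\<close>.\<close>
  define x where "x = 1 / (B * mu d)"
  define \<delta> where "\<delta> = (1 - x) / 2"
  have Bmu: "1 < B * mu d" using B mu by (simp add: field_simps)
  then have "0 < x" "x < 1" by (simp_all add: x_def)
  then have \<delta>: "0 < \<delta>" "\<delta> < 1" by (simp_all add: \<delta>_def)
  have "1 < B * ((1 - \<delta>) * mu d)"
  proof -
    have "B * ((1 - \<delta>) * mu d) = (B * mu d + 1) / 2"
      using B mu by (simp add: \<delta>_def x_def field_simps)
    then show ?thesis using Bmu by simp
  qed
  then have lim: "1 / ((1 - \<delta>) * mu d) < B" using mu \<delta> by (simp add: field_simps)
  have "\<forall>\<^sub>F q in sequentially. search_bound \<delta> d q < B"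
    using search_bound_tendsto[OF assms(2) \<delta>] lim by (rule order_tendstoD(2))
  moreover have "\<forall>\<^sub>F q in sequentially. root_prob d q > 0"
    using root_prob_tendsto mu by (rule order_tendstoD(1))
  \<comment> \<open>All three conditions depend on \<open>q\<close> alone, so one threshold serves
    all \<open>K\<close>, \<open>n\<close> and \<open>S\<close>. The condition
    \<open>d \<le> q\<close> provides the interpolation nodes for the exact root count.\<close>
  ultimately have "\<forall>\<^sub>F q in sequentially. \<forall>(K :: 'a ring) (n :: nat) (S :: 'a search_routine).
       field K \<and> finite (carrier K) \<and> order K = q \<longrightarrow>
       average_ops K r d n S \<le> real (tau K r d n S) * B + 0"
    using eventually_ge_at_top[of d]
  proof eventually_elim
    case (elim q)
    show ?case
    proof (intro allI impI, elim conjE)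
      fix K :: "'a ring" and n :: nat and S :: "'a search_routine"
      assume K: "field K" "finite (carrier K)" "order K = q"
      interpret field K by (rule K(1))
      interpret finite_field K by unfold_locales (rule K(2))
      have "average_ops K r d n S \<le> real (tau K r d n S) * search_bound \<delta> d (order K)"
        using elim K(3) by (intro average_ops_le assms \<delta>) auto
      also have "\<dots> \<le> real (tau K r d n S) * B"
        using elim K(3) by (intro mult_left_mono) auto
      finally show "average_ops K r d n S \<le> real (tau K r d n S) * B + 0" by simp
    qed
  qed
  then show ?thesis
    unfolding B_def by (intro exI[of _ "\<lambda>_. 0"]) simp
qed

end
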